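(* Let $d\ge2$, $\alpha_1,\dots,\alpha_d\in[1/2,2]$, $\mathbb{T}^d=\mathbb{R}^d/\prod_{j=1}^d\alpha_j\mathbb{Z}$, and let $I\subset\mathbb{R}$ be a bounded time interval. For every $\epsilon>0$ there is a constant $C$ such that for every integer $N\ge1$ and every $f\in L^2(\mathbb{T}^d)$ whose spectrum lies in $[-N,N]^d$, $$\|e^{it\Delta}f\|^2_{L^4_t(I;L^4_x(\mathbb{T}^d))}\le C\,N^{\frac13}\,\|f\|_{L^2}^2\quad\text{if } d=2,$$ $$\|e^{it\Delta}f\|^2_{L^4_t(I;L^4_x(\mathbb{T}^d))}\le C\,N^{\frac d2-\frac d{d+1}+\epsilon}\,\|f\|_{L^2}^2\quad\text{if } d\ge3 \text{ is odd},$$ $$\|e^{it\Delta}f\|^2_{L^4_t(I;L^4_x(\mathbb{T}^d))}\le C\,N^{\frac d2-1+\epsilon}\,\|f\|_{L^2}^2\quad\text{if } d\ge4 \text{ is even}.$$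
   Context: The spectrum of $f\in L^2(\mathbb{T}^d)$ is the set of $n\in\mathbb{Z}^d$ with $\hat f(n)\ne0$, where $f(x)=\sum_{n\in\mathbb{Z}^d}\hat f(n)\,e^{2\pi i\sum_j n_jx_j/\alpha_j}$. $e^{it\Delta}$ is the linear Schrödinger group on $\mathbb{T}^d$. *)

theory Defs
  imports "HOL-Analysis.Analysis"
begin

(* Extended nonnegative norms, so that a bound by a finite quantity includes the finiteness
   of the integral. The mixed norm of L^p(I; L^q(T)) is obtained by nesting. *)

definition ennreal_root :: "nat \<Rightarrow> ennreal \<Rightarrow> ennreal" where
  "ennreal_root p x = (if x = \<infinity> then \<infinity> else ennreal (root p (enn2real x)))"

definition Lp_norm :: "nat \<Rightarrow> 'a measure \<Rightarrow> ('a \<Rightarrow> ennreal) \<Rightarrow> ennreal" where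
  "Lp_norm p M g = ennreal_root p (\<integral>\<^sup>+x. g x ^ p \<partial>M)"

(* The torus R^d / (alpha_1 Z x ... x alpha_d Z): functions on it are periodic functions on R^d,
   and integrals over it are (unnormalised) Lebesgue integrals over the fundamental box. *)

definition fundamental_box :: "real^'n \<Rightarrow> (real^'n) set" where
  "fundamental_box \<alpha> = {x. \<forall>j. 0 \<le> x $ j \<and> x $ j < \<alpha> $ j}"

abbreviation torus :: "real^'n::finite \<Rightarrow> (real^'n) measure" where
  "torus \<alpha> \<equiv> lebesgue_on (fundamental_box \<alpha>)"

definition torus_periodic :: "real^'n::finite \<Rightarrow> (real^'n \<Rightarrow> complex) \<Rightarrow> bool" where
  "torus_periodic \<alpha> f \<longleftrightarrow> (\<forall>x j. f (x + axis j (\<alpha> $ j)) = f x)"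

abbreviation torus_norm :: "nat \<Rightarrow> real^'n::finite \<Rightarrow> (real^'n \<Rightarrow> complex) \<Rightarrow> ennreal" where
  "torus_norm p \<alpha> f \<equiv> Lp_norm p (torus \<alpha>) (\<lambda>x. ennreal (norm (f x)))"

(* Representatives are not identified up to null sets. *)

definition torus_L2 :: "real^'n::finite \<Rightarrow> (real^'n \<Rightarrow> complex) set" where
  "torus_L2 \<alpha> = {f \<in> borel_measurable lebesgue. torus_periodic \<alpha> f \<and> torus_norm 2 \<alpha> f < \<infinity>}"

definition torus_char :: "real^'n::finite \<Rightarrow> int^'n \<Rightarrow> real^'n \<Rightarrow> complex" where
  "torus_char \<alpha> n x = cis (2 * pi * (\<Sum>j\<in>UNIV. of_int (n $ j) * x $ j / \<alpha> $ j))"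

definition fourier_coeff :: "real^'n::finite \<Rightarrow> (real^'n \<Rightarrow> complex) \<Rightarrow> int^'n \<Rightarrow> complex" where
  "fourier_coeff \<alpha> f n =
     (\<integral>x. f x * cnj (torus_char \<alpha> n x) \<partial>torus \<alpha>) / of_real (\<Prod>j\<in>UNIV. \<alpha> $ j)"

definition spectrum :: "real^'n::finite \<Rightarrow> (real^'n \<Rightarrow> complex) \<Rightarrow> (int^'n) set" where
  "spectrum \<alpha> f = {n. fourier_coeff \<alpha> f n \<noteq> 0}"

(* The eigenvalue of minus the Laplacian on torus_char alpha n. *)

definition laplace_eigenvalue :: "real^'n::finite \<Rightarrow> int^'n \<Rightarrow> real" where
  "laplace_eigenvalue \<alpha> n = 4 * pi\<^sup>2 * (\<Sum>j\<in>UNIV. (of_int (n $ j) / \<alpha> $ j)\<^sup>2)"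

(* exp(i t Laplacian) f is the L^2 sum (along finite sets of frequencies) of the Fourier series
   of f with the n-th term multiplied by exp(-i t lambda_n). For f in L^2 the sum exists and is
   unique up to a null set; the choice operator picks a representative. *)

definition schrodinger_sum ::
    "real^'n::finite \<Rightarrow> real \<Rightarrow> (real^'n \<Rightarrow> complex) \<Rightarrow> (int^'n) set \<Rightarrow> real^'n \<Rightarrow> complex" where
  "schrodinger_sum \<alpha> t f F x =
     (\<Sum>n\<in>F. cis (- t * laplace_eigenvalue \<alpha> n) * fourier_coeff \<alpha> f n * torus_char \<alpha> n x)"

definition schrodinger ::
    "real^'n::finite \<Rightarrow> real \<Rightarrow> (real^'n \<Rightarrow> complex) \<Rightarrow> real^'n \<Rightarrow> complex" where
  "schrodinger \<alpha> t f = (SOME g. g \<in> torus_L2 \<alpha> \<and>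
     ((\<lambda>F. torus_norm 2 \<alpha> (\<lambda>x. g x - schrodinger_sum \<alpha> t f F x)) \<longlongrightarrow> 0)
       (finite_subsets_at_top UNIV))"

definition strichartz_norm ::
    "nat \<Rightarrow> nat \<Rightarrow> real set \<Rightarrow> real^'n::finite \<Rightarrow> (real^'n \<Rightarrow> complex) \<Rightarrow> ennreal" where
  "strichartz_norm p q I \<alpha> f =
     Lp_norm p (lebesgue_on I) (\<lambda>t. torus_norm q \<alpha> (schrodinger \<alpha> t f))"

end

theory Submission
  imports Defs
begin

text \<open>The square of the solution has \<open>k\<close>-th Fourier coefficient
  \<open>\<Sum>\<^bsub>n+m=k\<^esub> a\<^sub>n a\<^sub>m exp (- i t (\<lambda>\<^sub>n + \<lambda>\<^sub>m))\<close>. By Parseval in space and almost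
  orthogonality in time, the fourth power of its \<open>L\<^sup>4\<close> norm is at most \<open>M (\<Sum>\<bar>a\<^sub>n\<bar>\<^sup>2)\<^sup>2\<close>,
  up to a constant, where \<open>M\<close> is the largest number of pairs \<open>(n, m)\<close> with \<open>n + m = k\<close> and \<open>\<lambda>\<^sub>n + \<lambda>\<^sub>m\<close>
  in a window of length one. Since \<open>2 (\<lambda>\<^sub>n + \<lambda>\<^sub>m) = \<lambda>\<^bsub>n+m\<^esub> + \<lambda>\<^bsub>n-m\<^esub>\<close>, \<open>M\<close> counts lattice points
  \<open>l = n - m\<close> in a thin ellipsoidal shell.

  In dimension two the shell is cut into strips of width about \<open>A\<^bsup>1/6\<^esup>\<close>, where \<open>A\<close> is the square of the
  radius; three points in a strip span a triangle of area less than one half, hence are collinear, which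
  strict convexity forbids. This gives \<open>N\<^bsup>2/3\<^esup>\<close>. In higher dimension the Cauchy-Schwarz inequality
  reduces the count to the number of solutions of \<open>x\<^sup>2 - x'\<^sup>2 = y\<^sup>2 - y'\<^sup>2\<close>, which is
  \<open>O(N\<^bsup>2+\<epsilon>\<^esup>)\<close>: the window is shorter than every coefficient of the form, so that close values
  of a single summand must coincide. This gives \<open>N\<^bsup>3/2+\<epsilon>\<^esup>\<close> for \<open>d = 3\<close> and
  \<open>N\<^bsup>d-2+\<epsilon>\<^esup>\<close> for \<open>d \<ge> 4\<close>.\<close>

section \<open>Lattice points on thin ellipsoidal shells\<close>

text \<open>The count is a convolution of fibre sizes, the sum over m of r(m) s(i - m).
  Cauchy-Schwarz separates the two factors, and a sum of squared fibre sizes counts pairs with equal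
  values. The resulting bound does not depend on i.\<close>

lemma card_sum_fibre:
  fixes f :: "'a \<Rightarrow> int" and g :: "'b \<Rightarrow> int"
  assumes X: "finite X" and Y: "finite Y"
  shows "(card {p \<in> X \<times> Y. f (fst p) + g (snd p) = i})\<^sup>2
    \<le> card {p \<in> X \<times> X. f (fst p) = f (snd p)} * card {p \<in> Y \<times> Y. g (fst p) = g (snd p)}"
proof -
  define r where "r m = card {x \<in> X. f x = m}" for m
  define s where "s m = card {y \<in> Y. g y = m}" for m
  have "{p \<in> X \<times> Y. f (fst p) + g (snd p) = i}
      = (\<Union>m\<in>f ` X. {x \<in> X. f x = m} \<times> {y \<in> Y. g y = i - m})"
    by (auto simp: algebra_simps)
  then have 1: "card {p \<in> X \<times> Y. f (fst p) + g (snd p) = i} = (\<Sum>m\<in>f ` X. r m * s (i - m))"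
    using X Y by (simp only:, subst card_UN_disjoint) (auto simp: r_def s_def card_cartesian_product)
  have "{p \<in> X \<times> X. f (fst p) = f (snd p)} = (\<Union>m\<in>f ` X. {x \<in> X. f x = m} \<times> {x \<in> X. f x = m})"
    by auto
  then have 2: "card {p \<in> X \<times> X. f (fst p) = f (snd p)} = (\<Sum>m\<in>f ` X. (r m)\<^sup>2)"
    using X Y by (simp only:, subst card_UN_disjoint) (auto simp: r_def card_cartesian_product power2_eq_square)
  have "card (\<Union>m\<in>f ` X. {y \<in> Y. g y = i - m} \<times> {y \<in> Y. g y = i - m}) = (\<Sum>m\<in>f ` X. (s (i - m))\<^sup>2)"
    using X Y by (subst card_UN_disjoint) (auto simp: s_def card_cartesian_product power2_eq_square)
  moreover have "card (\<Union>m\<in>f ` X. {y \<in> Y. g y = i - m} \<times> {y \<in> Y. g y = i - m})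
      \<le> card {p \<in> Y \<times> Y. g (fst p) = g (snd p)}"
    using Y by (intro card_mono) auto
  \<comment> \<open>Only an inequality: i - m, for m in the range of f, may miss some values of
    g.\<close>
  ultimately have 3: "(\<Sum>m\<in>f ` X. (s (i - m))\<^sup>2) \<le> card {p \<in> Y \<times> Y. g (fst p) = g (snd p)}"
    by simp
  have "(\<Sum>m\<in>f ` X. real (r m) * real (s (i - m)))\<^sup>2
      \<le> (\<Sum>m\<in>f ` X. (real (r m))\<^sup>2) * (\<Sum>m\<in>f ` X. (real (s (i - m)))\<^sup>2)"
    by (rule Cauchy_Schwarz_ineq_sum)
  then have "real ((\<Sum>m\<in>f ` X. r m * s (i - m))\<^sup>2)
      \<le> real ((\<Sum>m\<in>f ` X. (r m)\<^sup>2) * (\<Sum>m\<in>f ` X. (s (i - m))\<^sup>2))"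
    by simp
  then have "(\<Sum>m\<in>f ` X. r m * s (i - m))\<^sup>2 \<le> (\<Sum>m\<in>f ` X. (r m)\<^sup>2) * (\<Sum>m\<in>f ` X. (s (i - m))\<^sup>2)"
    by (simp only: of_nat_le_iff)
  also have "\<dots> \<le> (\<Sum>m\<in>f ` X. (r m)\<^sup>2) * card {p \<in> Y \<times> Y. g (fst p) = g (snd p)}"
    using 3 by simp
  finally show ?thesis by (simp only: 1 2)
qed

text \<open>An additive energy in which coincidence of real values is replaced by coincidence of
  integer parts, so that the integer-valued \<open>card_sum_fibre\<close> applies.\<close>

definition floor_energy :: "'a set \<Rightarrow> ('a \<Rightarrow> real) \<Rightarrow> nat" where
  "floor_energy X u = card {p \<in> X \<times> X. \<lfloor>u (fst p)\<rfloor> = \<lfloor>u (snd p)\<rfloor>}"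

lemma card_sum_window:
  fixes u :: "'a \<Rightarrow> real" and v :: "'b \<Rightarrow> real"
  assumes X: "finite X" and Y: "finite Y"
  shows "real (card {p \<in> X \<times> Y. A \<le> u (fst p) + v (snd p) \<and> u (fst p) + v (snd p) < A + 2})
    \<le> 4 * sqrt (real (floor_energy X u) * real (floor_energy Y v))" (is "real (card ?P) \<le> _")
proof -
  let ?R = "\<lambda>i. {p \<in> X \<times> Y. \<lfloor>u (fst p)\<rfloor> + \<lfloor>v (snd p)\<rfloor> = i}"
  \<comment> \<open>Taking two floors loses less than two, so a sum in a window of length two has
    its sum of floors among four consecutive integers. This is the factor 4.\<close>
  have sub: "?P \<subseteq> (\<Union>i\<in>{\<lfloor>A\<rfloor> - 1..\<lfloor>A\<rfloor> + 2}. ?R i)"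
  proof
    fix p assume p: "p \<in> ?P"
    then have "\<lfloor>A\<rfloor> - 1 \<le> \<lfloor>u (fst p)\<rfloor> + \<lfloor>v (snd p)\<rfloor> \<and> \<lfloor>u (fst p)\<rfloor> + \<lfloor>v (snd p)\<rfloor> \<le> \<lfloor>A\<rfloor> + 2"
      by simp linarith
    with p show "p \<in> (\<Union>i\<in>{\<lfloor>A\<rfloor> - 1..\<lfloor>A\<rfloor> + 2}. ?R i)"
      by auto
  qed
  have fin: "finite (?R i)" for i using X Y by auto
  have "real ((card (?R i))\<^sup>2) \<le> real (floor_energy X u * floor_energy Y v)" for i
    unfolding floor_energy_def of_nat_le_iff
    using card_sum_fibre[OF X Y, of "\<lambda>x. \<lfloor>u x\<rfloor>" "\<lambda>x. \<lfloor>v x\<rfloor>" i] .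
  then have R: "real (card (?R i)) \<le> sqrt (real (floor_energy X u) * real (floor_energy Y v))" for i
    by (intro real_le_rsqrt) simp
  have "real (card ?P) \<le> real (card (\<Union>i\<in>{\<lfloor>A\<rfloor> - 1..\<lfloor>A\<rfloor> + 2}. ?R i))"
    using sub fin by (intro of_nat_mono card_mono) auto
  also have "\<dots> \<le> real (\<Sum>i\<in>{\<lfloor>A\<rfloor> - 1..\<lfloor>A\<rfloor> + 2}. card (?R i))"
    by (intro of_nat_mono card_UN_le) auto
  also have "\<dots> \<le> (\<Sum>i\<in>{\<lfloor>A\<rfloor> - 1..\<lfloor>A\<rfloor> + 2}. sqrt (real (floor_energy X u) * real (floor_energy Y v)))"
    using R by (simp only: of_nat_sum) (rule sum_mono)
  also have "\<dots> = 4 * sqrt (real (floor_energy X u) * real (floor_energy Y v))"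
    by simp
  finally show ?thesis .
qed

text \<open>Distinct integers scaled by a factor of at least one stay at distance at least one. This
  is how real coefficients drop out: all later energies are bounded by counts of integer equations,
  uniformly in the coefficients.\<close>

lemma floor_eq_imp_eq_of_int:
  fixes a b :: int
  assumes "\<lfloor>\<beta> * of_int a\<rfloor> = \<lfloor>\<beta> * of_int b\<rfloor>" and "1 \<le> (\<beta>::real)"
  shows "a = b"
proof (rule ccontr)
  assume "a \<noteq> b"
  then have "1 \<le> \<bar>real_of_int (a - b)\<bar>" by linarith
  then have "1 \<le> \<beta> * \<bar>real_of_int (a - b)\<bar>" 
    using assms(2) mult_mono[of 1 \<beta> 1 "\<bar>real_of_int (a - b)\<bar>"] by simp
  then have "1 \<le> \<bar>\<beta> * real_of_int a - \<beta> * real_of_int b\<bar>"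
    using assms(2) by (simp add: abs_mult flip: right_diff_distrib)
  then show False using assms(1) by linarith
qed

definition square_energy :: "int \<Rightarrow> nat" where
  "square_energy H = card {((x, x'), (y, y')). {x, x', y, y'} \<subseteq> {-H..H} \<and> x\<^sup>2 - x'\<^sup>2 = y\<^sup>2 - y'\<^sup>2}"

text \<open>Coinciding floors force equal squares, so each x has at most the partners x and
  -x.\<close>

lemma floor_energy_square:
  assumes "1 \<le> \<beta>" and "0 \<le> H"
  shows "floor_energy {-H..H} (\<lambda>x. \<beta> * of_int (x\<^sup>2)) \<le> 2 * nat (2 * H + 1)"
proof -
  have "{p \<in> {-H..H} \<times> {-H..H}. \<lfloor>\<beta> * of_int ((fst p)\<^sup>2)\<rfloor> = \<lfloor>\<beta> * of_int ((snd p)\<^sup>2)\<rfloor>}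
      \<subseteq> (\<lambda>(x, s). (x, s * x)) ` ({-H..H} \<times> {1, -1})"
  proof
    fix p assume p: "p \<in> {p \<in> {-H..H} \<times> {-H..H}. \<lfloor>\<beta> * of_int ((fst p)\<^sup>2)\<rfloor> = \<lfloor>\<beta> * of_int ((snd p)\<^sup>2)\<rfloor>}"
    then have "\<lfloor>\<beta> * of_int ((fst p)\<^sup>2)\<rfloor> = \<lfloor>\<beta> * of_int ((snd p)\<^sup>2)\<rfloor>" by blast
    then have "(fst p)\<^sup>2 = (snd p)\<^sup>2" using floor_eq_imp_eq_of_int assms(1) by blast
    then have "snd p = fst p \<or> snd p = - fst p" by (metis power2_eq_iff)
    with p show "p \<in> (\<lambda>(x, s). (x, s * x)) ` ({-H..H} \<times> {1, -1})"
      by (cases p) (auto simp: image_iff)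
  qed
  then have "floor_energy {-H..H} (\<lambda>x. \<beta> * of_int (x\<^sup>2)) \<le> card ((\<lambda>(x, s). (x, s * x)) ` ({-H..H} \<times> {1, -1::int}))"
    unfolding floor_energy_def by (intro card_mono) auto
  also have "\<dots> \<le> card ({-H..H} \<times> {1, -1::int})"
    by (intro card_image_le) auto
  also have "\<dots> = 2 * nat (2 * H + 1)" using assms(2) by (simp add: card_cartesian_product)
  finally show ?thesis .
qed

lemma floor_energy_square_diff:
  assumes "1 \<le> \<beta>"
  shows "floor_energy ({-H..H} \<times> {-H..H}) (\<lambda>(x, x'). \<beta> * of_int (x\<^sup>2 - x'\<^sup>2)) \<le> square_energy H"
  unfolding floor_energy_def square_energy_def
proof (rule card_mono)
  have "{((x, x'), (y, y')). {x, x', y, y'} \<subseteq> {-H..H} \<and> x\<^sup>2 - x'\<^sup>2 = y\<^sup>2 - y'\<^sup>2}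
      \<subseteq> ({-H..H} \<times> {-H..H}) \<times> ({-H..H} \<times> {-H..H})" by auto
  then show "finite {((x, x'), (y, y')). {x, x', y, y'} \<subseteq> {-H..H} \<and> x\<^sup>2 - x'\<^sup>2 = y\<^sup>2 - y'\<^sup>2}"
    by (rule finite_subset) auto
  let ?u = "\<lambda>(x, x'). \<beta> * of_int (x\<^sup>2 - x'\<^sup>2) :: real"
  show "{p \<in> ({-H..H} \<times> {-H..H}) \<times> ({-H..H} \<times> {-H..H}). \<lfloor>?u (fst p)\<rfloor> = \<lfloor>?u (snd p)\<rfloor>}
    \<subseteq> {((x, x'), (y, y')). {x, x', y, y'} \<subseteq> {-H..H} \<and> x\<^sup>2 - x'\<^sup>2 = y\<^sup>2 - y'\<^sup>2}"
  proof
    fix p assume p: "p \<in> {p \<in> ({-H..H} \<times> {-H..H}) \<times> ({-H..H} \<times> {-H..H}). \<lfloor>?u (fst p)\<rfloor> = \<lfloor>?u (snd p)\<rfloor>}"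
    obtain x x' y y' where xy: "p = ((x, x'), (y, y'))" by (metis surj_pair)
    with p have "\<lfloor>\<beta> * of_int (x\<^sup>2 - x'\<^sup>2)\<rfloor> = \<lfloor>\<beta> * of_int (y\<^sup>2 - y'\<^sup>2)\<rfloor>"
      by (simp only: mem_Collect_eq fst_conv snd_conv prod.case)
    then have "x\<^sup>2 - x'\<^sup>2 = y\<^sup>2 - y'\<^sup>2" using floor_eq_imp_eq_of_int assms by blast
    with p show "p \<in> {((x, x'), (y, y')). {x, x', y, y'} \<subseteq> {-H..H} \<and> x\<^sup>2 - x'\<^sup>2 = y\<^sup>2 - y'\<^sup>2}"
      unfolding xy by simp
  qed
qed

text \<open>The four variables are regrouped. Two values with equal floors differ by less than one,
  so the sum of a function of (x, x') and a function of (y, y') lies in the window [-1, 1). Applying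
  \<open>card_sum_window\<close> to these two functions leaves only energies of differences of
  squares.\<close>

lemma floor_energy_binary:
  assumes b: "1 \<le> \<beta>" "1 \<le> \<gamma>"
  shows "floor_energy ({-H..H} \<times> {-H..H}) (\<lambda>(x, y). \<beta> * of_int (x\<^sup>2) + \<gamma> * of_int (y\<^sup>2))
    \<le> 4 * square_energy H"
proof -
  let ?B = "{-H..H} \<times> {-H..H}"
  let ?u = "\<lambda>\<beta> (x, x'). \<beta> * of_int (x\<^sup>2 - x'\<^sup>2) :: real"
  let ?S = "{p \<in> ?B \<times> ?B. -1 \<le> ?u \<beta> (fst p) + ?u \<gamma> (snd p) \<and> ?u \<beta> (fst p) + ?u \<gamma> (snd p) < -1 + 2}"
  let ?E = "{p \<in> ?B \<times> ?B. \<lfloor>case fst p of (x, y) \<Rightarrow> \<beta> * of_int (x\<^sup>2) + \<gamma> * of_int (y\<^sup>2)\<rfloor>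
     = \<lfloor>case snd p of (x, y) \<Rightarrow> \<beta> * of_int (x\<^sup>2) + \<gamma> * of_int (y\<^sup>2)\<rfloor>}"
  have "card ?E \<le> card ?S"
  proof (rule card_inj_on_le)
    show "inj_on (\<lambda>((x, y), (x', y')). ((x, x'), (y, y'))) ?E"
      by (auto simp: inj_on_def)
    show "(\<lambda>((x, y), (x', y')). ((x, x'), (y, y'))) ` ?E \<subseteq> ?S"
    proof
      fix p assume "p \<in> (\<lambda>((x, y), (x', y')). ((x, x'), (y, y'))) ` ?E"
      then obtain x y x' y' where p: "p = ((x, x'), (y, y'))" and mem: "((x, y), (x', y')) \<in> ?B \<times> ?B"
        and "\<lfloor>\<beta> * of_int (x\<^sup>2) + \<gamma> * of_int (y\<^sup>2)\<rfloor> = \<lfloor>\<beta> * of_int (x'\<^sup>2) + \<gamma> * of_int (y'\<^sup>2)\<rfloor>"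
        by force
      then have "\<bar>(\<beta> * of_int (x\<^sup>2) + \<gamma> * of_int (y\<^sup>2)) - (\<beta> * of_int (x'\<^sup>2) + \<gamma> * of_int (y'\<^sup>2))\<bar> < 1"
        by linarith
      then have "\<bar>\<beta> * of_int (x\<^sup>2 - x'\<^sup>2) + \<gamma> * of_int (y\<^sup>2 - y'\<^sup>2)\<bar> < 1"
        by (simp add: algebra_simps)
      with mem show "p \<in> ?S" by (auto simp: p)
    qed
  qed auto
  then have "real (floor_energy ?B (\<lambda>(x, y). \<beta> * of_int (x\<^sup>2) + \<gamma> * of_int (y\<^sup>2))) \<le> real (card ?S)"
    unfolding floor_energy_def by simp
  also have "\<dots> \<le> 4 * sqrt (real (floor_energy ?B (?u \<beta>)) * real (floor_energy ?B (?u \<gamma>)))"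
    by (rule card_sum_window) auto
  also have "\<dots> \<le> 4 * sqrt (real (square_energy H) * real (square_energy H))"
    using floor_energy_square_diff[OF b(1), of H] floor_energy_square_diff[OF b(2), of H]
    by (intro mult_left_mono real_sqrt_le_mono mult_mono of_nat_mono) auto
  also have "\<dots> = real (4 * square_energy H)" by simp
  finally show ?thesis by (simp only: of_nat_le_iff)
qed

section \<open>The equation u v = w z and the energy of the squares\<close>

text \<open>A solution is described by g, k, s, t, and for given g and k both s and t are at most M
  / max(g, k). The count is therefore at most the sum of (M / max(g, k))^2 over g and k, and max(g,
  k)^2 >= g k splits this into a product of two harmonic sums.\<close>

lemma card_product_eq_product:
  "real (card {(u, v, w, z). {u, v, w, z} \<subseteq> {1..M::nat} \<and> u * v = w * z})
    \<le> (real M)\<^sup>2 * (\<Sum>k=1..M. 1 / real k)\<^sup>2"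
proof -
  let ?f = "\<lambda>((g, k), (s, t)). (g * s, t * k, g * t, s * k :: nat)"
  let ?D = "SIGMA p:{1..M} \<times> {1..M}. {1..M div max (fst p) (snd p)} \<times> {1..M div max (fst p) (snd p)}"
  have "{(u, v, w, z). {u, v, w, z} \<subseteq> {1..M} \<and> u * v = w * z} \<subseteq> ?f ` ?D"
  proof clarify
    fix u v w z assume le: "{u, v, w, z} \<subseteq> {1..M}" and eq: "u * v = w * z"
    define g where "g = gcd u w"
    have "g > 0" using le by (simp add: g_def)
    \<comment> \<open>the solutions of \<open>u v = w z\<close> are \<open>(g s) (t k) = (g t) (s k)\<close>\<close>
    obtain s t where st: "u = g * s" "w = g * t" "coprime s t"
      using gcd_coprime_exists[of u w] \<open>g > 0\<close> unfolding g_def by (metis mult.commute less_numeral_extra(3))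
    have "s * v = t * z" using eq st \<open>g > 0\<close> by simp
    then have "t dvd v" using st(3) by (metis coprime_commute coprime_dvd_mult_right_iff dvd_triv_left)
    then obtain k where k: "v = t * k" by blast
    have pos: "s > 0" "t > 0" "k > 0" using le st k by (auto intro!: gr0I)
    have z: "z = s * k" using \<open>s * v = t * z\<close> k pos by simp
    have "s * max g k \<le> M" "t * max g k \<le> M" using le st k z by (auto simp: max_def mult.commute)
    then have "s \<le> M div max g k" "t \<le> M div max g k"
      using \<open>g > 0\<close> by (auto simp: less_eq_div_iff_mult_less_eq max_def)
    moreover have "g \<le> M" using le st pos by (metis insert_subset atLeastAtMost_iff dvd_imp_le dvd_trans dvd_triv_left order_trans mult_pos_pos \<open>g > 0\<close>)
    moreover have "k \<le> M" using le k pos by (metis insert_subset atLeastAtMost_iff dvd_imp_le dvd_triv_right order_trans mult_pos_pos)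
    ultimately have "((g, k), (s, t)) \<in> ?D" using pos \<open>g > 0\<close> by auto
    then show "(u, v, w, z) \<in> ?f ` ?D" using st k z by (force simp: image_iff)
  qed
  then have "card {(u, v, w, z). {u, v, w, z} \<subseteq> {1..M} \<and> u * v = w * z} \<le> card (?f ` ?D)"
    by (intro card_mono) auto
  also have "\<dots> \<le> card ?D" by (intro card_image_le) auto
  also have "\<dots> = (\<Sum>p\<in>{1..M} \<times> {1..M}. (M div max (fst p) (snd p))\<^sup>2)"
    by (simp add: card_SigmaI card_cartesian_product power2_eq_square)
  finally have "real (card {(u, v, w, z). {u, v, w, z} \<subseteq> {1..M} \<and> u * v = w * z})
      \<le> real (\<Sum>p\<in>{1..M} \<times> {1..M}. (M div max (fst p) (snd p))\<^sup>2)"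
    by (simp only: of_nat_le_iff)
  also have "\<dots> \<le> (\<Sum>p\<in>{1..M} \<times> {1..M}. (real M * (1 / real (fst p))) * (real M * (1 / real (snd p))))"
    unfolding of_nat_sum
  proof (rule sum_mono)
    fix p assume "p \<in> {1..M} \<times> {1..M}"
    have d: "real (M div m) \<le> real M * (1 / real m)" for m
      using of_nat_div_le_of_nat by simp
    have "(M div max (fst p) (snd p))\<^sup>2 \<le> (M div fst p) * (M div snd p)"
      unfolding power2_eq_square using \<open>p \<in> _\<close> by (intro mult_mono div_le_mono2) auto
    then have "real ((M div max (fst p) (snd p))\<^sup>2) \<le> real (M div fst p) * real (M div snd p)"
      by (metis of_nat_le_iff of_nat_mult)
    also have "\<dots> \<le> (real M * (1 / real (fst p))) * (real M * (1 / real (snd p)))"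
      using d by (intro mult_mono) auto
    finally show "real ((M div max (fst p) (snd p))\<^sup>2) \<le> \<dots>" .
  qed
  also have "\<dots> = (real M)\<^sup>2 * (\<Sum>k=1..M. 1 / real k)\<^sup>2"
    by (simp add: power2_eq_square sum_product sum.cartesian_product sum_distrib_left case_prod_unfold algebra_simps)
  finally show ?thesis .
qed

lemma card_zero_product_quadruples:
  "card {(u, v, w, z). {u, v, w, z} \<subseteq> {-M..M::int} \<and> u * v = 0 \<and> w * z = 0} \<le> 4 * (nat (2 * M + 1))\<^sup>2"
proof -
  define P where "P = {0} \<times> {-M..M} \<union> {-M..M} \<times> {0}"
  have P: "card P \<le> 2 * nat (2 * M + 1)"
    unfolding P_def by (rule order_trans[OF card_Un_le]) (auto simp: card_cartesian_product)
  have fin: "finite P" by (auto simp: P_def)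
  have "card {(u, v, w, z). {u, v, w, z} \<subseteq> {-M..M} \<and> u * v = 0 \<and> w * z = 0} \<le> card (P \<times> P)"
    by (rule card_inj_on_le[where f = "\<lambda>(u, v, w, z). ((u, v), (w, z))"])
       (auto simp: inj_on_def P_def)
  also have "\<dots> \<le> (2 * nat (2 * M + 1)) * (2 * nat (2 * M + 1))"
    unfolding card_cartesian_product using P by (intro mult_mono) auto
  finally show ?thesis by (simp add: power2_eq_square)
qed

text \<open>Differences of squares factor, which leads to u v = w z with entries up to 2H in
  absolute value. Solutions with vanishing products are counted separately; the others are positive
  solutions with one of 16 sign patterns.\<close>

lemma square_energy_le:
  assumes "0 \<le> H"
  shows "real (square_energy H) \<le> 4 * (real_of_int (4 * H + 1))\<^sup>2
    + 16 * ((real_of_int (2 * H))\<^sup>2 * (\<Sum>k=1..nat (2 * H). 1 / real k)\<^sup>2)"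
proof -
  define M where "M = 2 * H"
  define B where "B = {-M..M}"
  define Z where "Z = {(u, v, w, z). {u, v, w, z} \<subseteq> B \<and> u * v = 0 \<and> w * z = 0}"
  define Q where "Q = {(u, v, w, z). {u, v, w, z} \<subseteq> {1..nat M} \<and> u * v = w * z}"
  define S where "S = {1, -1::int} \<times> {1, -1::int} \<times> {1, -1::int} \<times> {1, -1::int}"
  define h where "h = (\<lambda>((a, b, c, d), (u, v, w, z)). (a * int u, b * int v, c * int w, d * int z))"
  have "Q \<subseteq> {1..nat M} \<times> {1..nat M} \<times> {1..nat M} \<times> {1..nat M}" by (auto simp: Q_def)
  then have finQ: "finite Q" by (rule finite_subset) auto
  have "Z \<subseteq> B \<times> B \<times> B \<times> B" by (auto simp: Z_def)
  then have finZ: "finite Z" by (rule finite_subset) (auto simp: B_def)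
  have finS: "finite S" and cardS: "card S = 16" by (auto simp: S_def card_cartesian_product)
  have sgn: "sgn t \<in> {1, -1} \<and> t = sgn t * int (nat \<bar>t\<bar>) \<and> nat \<bar>t\<bar> \<in> {1..nat M}" if "t \<in> B" "t \<noteq> 0" for t :: int
    using that by (auto simp: sgn_if B_def)
  let ?T = "{(u, v, w, z). {u, v, w, z} \<subseteq> B \<and> u * v = w * z}"
  have T: "?T \<subseteq> Z \<union> h ` (S \<times> Q)"
  proof
    fix p assume "p \<in> ?T"
    then obtain u v w z where p: "p = (u, v, w, z)" and mem: "u \<in> B" "v \<in> B" "w \<in> B" "z \<in> B"
      and eq: "u * v = w * z" by auto
    show "p \<in> Z \<union> h ` (S \<times> Q)"
    proof (cases "u * v = 0")
      case True
      then show ?thesis using mem eq by (auto simp: Z_def p)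
    next
      case False
      then have nz: "u \<noteq> 0" "v \<noteq> 0" "w \<noteq> 0" "z \<noteq> 0" using eq by auto
      define q where "q = ((sgn u, sgn v, sgn w, sgn z), (nat \<bar>u\<bar>, nat \<bar>v\<bar>, nat \<bar>w\<bar>, nat \<bar>z\<bar>))"
      have "nat \<bar>u\<bar> * nat \<bar>v\<bar> = nat \<bar>w\<bar> * nat \<bar>z\<bar>"
        using eq by (simp add: nat_abs_mult_distrib[symmetric])
      then have "q \<in> S \<times> Q"
        using sgn[OF mem(1) nz(1)] sgn[OF mem(2) nz(2)] sgn[OF mem(3) nz(3)] sgn[OF mem(4) nz(4)]
        unfolding q_def S_def Q_def
        by (simp only: mem_Sigma_iff mem_Collect_eq prod.case insert_subset) blast
      moreover have "p = h q"
        using sgn[OF mem(1) nz(1)] sgn[OF mem(2) nz(2)] sgn[OF mem(3) nz(3)] sgn[OF mem(4) nz(4)]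
        unfolding q_def h_def p by simp
      ultimately show ?thesis by blast
    qed
  qed
  have finT: "finite ?T" by (rule finite_subset[OF T]) (use finZ finS finQ in auto)
  have cZ: "card Z \<le> 4 * (nat (2 * M + 1))\<^sup>2"
    unfolding Z_def B_def by (rule card_zero_product_quadruples)
  have cQ: "card (h ` (S \<times> Q)) \<le> 16 * card Q"
    using card_image_le[of "S \<times> Q" h] finS finQ by (simp add: card_cartesian_product cardS)
  \<comment> \<open>The change of variables u = x - x', v = x + x' is injective but not onto, by
    parity; an upper bound is all that is wanted.\<close>
  have "square_energy H \<le> card ?T"
    unfolding square_energy_def
    by (rule card_inj_on_le[where f = "\<lambda>((x, x'), (y, y')). (x - x', x + x', y - y', y + y')", OF _ _ finT])
       (auto simp: inj_on_def B_def M_def power2_eq_square algebra_simps)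
  also have "\<dots> \<le> card (Z \<union> h ` (S \<times> Q))"
    using T finZ finS finQ by (intro card_mono) auto
  also have "\<dots> \<le> card Z + card (h ` (S \<times> Q))" by (rule card_Un_le)
  also have "\<dots> \<le> 4 * (nat (2 * M + 1))\<^sup>2 + 16 * card Q"
    using cZ cQ by (rule add_mono)
  finally have "real (square_energy H) \<le> real (4 * (nat (2 * M + 1))\<^sup>2 + 16 * card Q)"
    by (simp only: of_nat_le_iff)
  then have "real (square_energy H) \<le> 4 * (real (nat (2 * M + 1)))\<^sup>2 + 16 * real (card Q)"
    by (simp only: of_nat_add of_nat_mult of_nat_numeral of_nat_power)
  also have "\<dots> \<le> 4 * (real (nat (2 * M + 1)))\<^sup>2 + 16 * ((real (nat M))\<^sup>2 * (\<Sum>k=1..nat M. 1 / real k)\<^sup>2)"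
    using card_product_eq_product[of "nat M"] unfolding Q_def by simp
  finally show ?thesis using assms by (simp add: M_def)
qed

text \<open>Write 1/k = k^(-1-\<delta>) k^\<delta> and bound the second factor by M^\<delta>; the
  series of the first factors converges. The 1 added to its sum makes the constant visibly
  positive.\<close>

lemma harmonic_sum_le_powr:
  fixes \<delta> :: real
  assumes "0 < \<delta>"
  shows "\<exists>C>0. \<forall>M. (\<Sum>k=1..M. 1 / real k) \<le> C * real M powr \<delta>"
proof -
  define s where "s = (\<lambda>k. real k powr (- 1 - \<delta>))"
  have sum: "summable s" using assms by (simp add: s_def summable_real_powr_iff)
  have "(\<Sum>k=1..M. 1 / real k) \<le> (suminf s + 1) * real M powr \<delta>" for M
  proof -
    have "(\<Sum>k=1..M. 1 / real k) \<le> (\<Sum>k=1..M. s k * real M powr \<delta>)"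
    proof (rule sum_mono)
      fix k assume k: "k \<in> {1..M}"
      have "1 / real k = s k * real k powr \<delta>"
        using k by (simp add: s_def powr_minus_divide flip: powr_add)
      also have "\<dots> \<le> s k * real M powr \<delta>"
        using k assms by (intro mult_left_mono powr_mono2) (auto simp: s_def)
      finally show "1 / real k \<le> s k * real M powr \<delta>" .
    qed
    also have "\<dots> = sum s {1..M} * real M powr \<delta>" by (simp add: sum_distrib_right)
    also have "\<dots> \<le> (suminf s + 1) * real M powr \<delta>"
      using sum_le_suminf[OF sum, of "{1..M}"] by (intro mult_right_mono) (auto simp: s_def)
    finally show ?thesis .
  qed
  moreover have "suminf s + 1 > 0" using suminf_nonneg[OF sum] by (simp add: s_def)
  ultimately show ?thesis by blast
qed

lemma square_energy_bound:
  fixes \<epsilon> :: real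
  assumes "0 < \<epsilon>"
  shows "\<exists>C>0. \<forall>H\<ge>1. real (square_energy H) \<le> C * real_of_int H powr (2 + \<epsilon>)"
proof -
  \<comment> \<open>Half of \<epsilon>, because the harmonic sum enters squared.\<close>
  obtain D where D: "D > 0" "\<And>M. (\<Sum>k=1..M. 1 / real k) \<le> D * real M powr (\<epsilon> / 2)"
    using harmonic_sum_le_powr[of "\<epsilon> / 2"] assms by auto
  define C where "C = 100 + 64 * D\<^sup>2 * 2 powr \<epsilon>"
  have "real (square_energy H) \<le> C * real_of_int H powr (2 + \<epsilon>)" if H: "1 \<le> H" for H
  proof -
    let ?H = "real_of_int H"
    have H1: "1 \<le> ?H" using H by simp
    have p: "?H powr (2 + \<epsilon>) = ?H\<^sup>2 * ?H powr \<epsilon>"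
      using H1 by (simp add: powr_add)
    have "(real_of_int (4 * H + 1))\<^sup>2 \<le> (5 * ?H)\<^sup>2"
      using H1 by (intro power_mono) auto
    also have "\<dots> \<le> 25 * (?H\<^sup>2 * ?H powr \<epsilon>)"
      using H1 assms ge_one_powr_ge_zero[of ?H \<epsilon>] by (simp add: power_mult_distrib mult_le_cancel_left1)
    finally have 1: "(real_of_int (4 * H + 1))\<^sup>2 \<le> 25 * (?H\<^sup>2 * ?H powr \<epsilon>)" .
    have half: "(x powr (\<epsilon> / 2))\<^sup>2 = x powr \<epsilon>" for x
      by (simp add: power2_eq_square flip: powr_add)
    have "(\<Sum>k=1..nat (2 * H). 1 / real k)\<^sup>2 \<le> (D * real (nat (2 * H)) powr (\<epsilon> / 2))\<^sup>2"
      by (intro power_mono D(2) sum_nonneg) auto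
    also have "\<dots> = D\<^sup>2 * (2 powr \<epsilon> * ?H powr \<epsilon>)"
      using H1 by (simp add: power_mult_distrib powr_mult half)
    finally have 2: "(\<Sum>k=1..nat (2 * H). 1 / real k)\<^sup>2 \<le> D\<^sup>2 * (2 powr \<epsilon> * ?H powr \<epsilon>)" .
    have "real (square_energy H) \<le> 4 * (25 * (?H\<^sup>2 * ?H powr \<epsilon>))
        + 16 * ((real_of_int (2 * H))\<^sup>2 * (D\<^sup>2 * (2 powr \<epsilon> * ?H powr \<epsilon>)))"
      using H 1 2 by (intro order_trans[OF square_energy_le] add_mono mult_left_mono) auto
    also have "\<dots> = C * ?H powr (2 + \<epsilon>)"
      unfolding p C_def by (simp add: algebra_simps power_mult_distrib)
    finally show ?thesis .
  qed
  moreover have "C > 0" unfolding C_def by (intro add_pos_nonneg) auto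
  ultimately show ?thesis by blast
qed

section \<open>Windows of ternary and quaternary forms\<close>

text \<open>Split as two variables plus one. The energies are of order H^(2+\<epsilon>) and H, and
  their geometric mean is of order H^(3/2+\<epsilon>/2).\<close>

lemma card_ternary_window:
  fixes \<beta>1 \<beta>2 \<beta>3 A :: real
  assumes "1 \<le> \<beta>1" "1 \<le> \<beta>2" "1 \<le> \<beta>3" "0 \<le> H"
  shows "real (card {((x, y), z). {x, y, z} \<subseteq> {-H..H} \<and> A \<le> \<beta>1 * of_int (x\<^sup>2) + \<beta>2 * of_int (y\<^sup>2) + \<beta>3 * of_int (z\<^sup>2)
      \<and> \<beta>1 * of_int (x\<^sup>2) + \<beta>2 * of_int (y\<^sup>2) + \<beta>3 * of_int (z\<^sup>2) < A + 2})
    \<le> 4 * sqrt (real (4 * square_energy H) * real (2 * nat (2 * H + 1)))"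
proof -
  let ?B = "{-H..H} \<times> {-H..H}"
  let ?u = "\<lambda>(x, y). \<beta>1 * of_int (x\<^sup>2) + \<beta>2 * of_int (y\<^sup>2)"
  let ?v = "\<lambda>z. \<beta>3 * of_int (z\<^sup>2)"
  have "{((x, y), z). {x, y, z} \<subseteq> {-H..H} \<and> A \<le> \<beta>1 * of_int (x\<^sup>2) + \<beta>2 * of_int (y\<^sup>2) + \<beta>3 * of_int (z\<^sup>2)
      \<and> \<beta>1 * of_int (x\<^sup>2) + \<beta>2 * of_int (y\<^sup>2) + \<beta>3 * of_int (z\<^sup>2) < A + 2}
    = {p \<in> ?B \<times> {-H..H}. A \<le> ?u (fst p) + ?v (snd p) \<and> ?u (fst p) + ?v (snd p) < A + 2}"
    by (auto simp del: of_int_power)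
  then have "real (card {((x, y), z). {x, y, z} \<subseteq> {-H..H} \<and> A \<le> \<beta>1 * of_int (x\<^sup>2) + \<beta>2 * of_int (y\<^sup>2) + \<beta>3 * of_int (z\<^sup>2)
      \<and> \<beta>1 * of_int (x\<^sup>2) + \<beta>2 * of_int (y\<^sup>2) + \<beta>3 * of_int (z\<^sup>2) < A + 2})
    \<le> 4 * sqrt (real (floor_energy ?B ?u) * real (floor_energy {-H..H} ?v))"
    by (simp only:) (rule card_sum_window; simp)
  also have "\<dots> \<le> 4 * sqrt (real (4 * square_energy H) * real (2 * nat (2 * H + 1)))"
    using floor_energy_binary[OF assms(1,2), of H] floor_energy_square[OF assms(3,4)]
    by (intro mult_left_mono real_sqrt_le_mono mult_mono of_nat_mono) auto
  finally show ?thesis .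
qed

text \<open>Split as two variables plus two: both energies are of order H^(2+\<epsilon>), hence so
  is their geometric mean.\<close>

lemma card_quaternary_window:
  fixes \<beta>1 \<beta>2 \<beta>3 \<beta>4 A :: real
  assumes "1 \<le> \<beta>1" "1 \<le> \<beta>2" "1 \<le> \<beta>3" "1 \<le> \<beta>4"
  shows "real (card {((x, y), (z, w)). {x, y, z, w} \<subseteq> {-H..H}
      \<and> A \<le> \<beta>1 * of_int (x\<^sup>2) + \<beta>2 * of_int (y\<^sup>2) + \<beta>3 * of_int (z\<^sup>2) + \<beta>4 * of_int (w\<^sup>2)
      \<and> \<beta>1 * of_int (x\<^sup>2) + \<beta>2 * of_int (y\<^sup>2) + \<beta>3 * of_int (z\<^sup>2) + \<beta>4 * of_int (w\<^sup>2) < A + 2})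
    \<le> 16 * real (square_energy H)"
proof -
  let ?B = "{-H..H} \<times> {-H..H}"
  let ?u = "\<lambda>(x, y). \<beta>1 * of_int (x\<^sup>2) + \<beta>2 * of_int (y\<^sup>2)"
  let ?v = "\<lambda>(x, y). \<beta>3 * of_int (x\<^sup>2) + \<beta>4 * of_int (y\<^sup>2)"
  have "{((x, y), (z, w)). {x, y, z, w} \<subseteq> {-H..H}
      \<and> A \<le> \<beta>1 * of_int (x\<^sup>2) + \<beta>2 * of_int (y\<^sup>2) + \<beta>3 * of_int (z\<^sup>2) + \<beta>4 * of_int (w\<^sup>2)
      \<and> \<beta>1 * of_int (x\<^sup>2) + \<beta>2 * of_int (y\<^sup>2) + \<beta>3 * of_int (z\<^sup>2) + \<beta>4 * of_int (w\<^sup>2) < A + 2}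
    = {p \<in> ?B \<times> ?B. A \<le> ?u (fst p) + ?v (snd p) \<and> ?u (fst p) + ?v (snd p) < A + 2}"
    by (auto simp del: of_int_power simp: add.assoc)
  then have "real (card {((x, y), (z, w)). {x, y, z, w} \<subseteq> {-H..H}
      \<and> A \<le> \<beta>1 * of_int (x\<^sup>2) + \<beta>2 * of_int (y\<^sup>2) + \<beta>3 * of_int (z\<^sup>2) + \<beta>4 * of_int (w\<^sup>2)
      \<and> \<beta>1 * of_int (x\<^sup>2) + \<beta>2 * of_int (y\<^sup>2) + \<beta>3 * of_int (z\<^sup>2) + \<beta>4 * of_int (w\<^sup>2) < A + 2})
    \<le> 4 * sqrt (real (floor_energy ?B ?u) * real (floor_energy ?B ?v))"
    by (simp only:) (rule card_sum_window; simp)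
  also have "\<dots> \<le> 4 * sqrt (real (4 * square_energy H) * real (4 * square_energy H))"
    using floor_energy_binary[OF assms(1,2), of H] floor_energy_binary[OF assms(3,4), of H]
    by (intro mult_left_mono real_sqrt_le_mono mult_mono of_nat_mono) auto
  also have "\<dots> = 16 * real (square_energy H)"
    by (simp only: real_sqrt_abs2)
  finally show ?thesis .
qed

section \<open>Thin elliptical annuli\<close>

text \<open>In the cone where the y-term dominates, the ellipse is a graph over x with bounded
  slope. Concretely, b |y - y'| (y + y') is at most 2 + a |x - x'| |x + x'|, where |x + x'| is at
  most 5 (y + y'), and y + y' cancels. For integer heights the alternative
  \<open>y = y' \<or> 1 \<le> y + y'\<close> is automatic.\<close>

lemma strip_height_diff:
  fixes a b A L x y x' y' :: real
  assumes ab: "9 \<le> a" "a \<le> 160" "9 \<le> b" "b \<le> 160" and L: "1 \<le> L" "\<bar>x - x'\<bar> \<le> L"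
    and y: "0 \<le> y" "0 \<le> y'" "y = y' \<or> 1 \<le> y + y'"
    and cone: "a * x\<^sup>2 \<le> b * y\<^sup>2" "a * x'\<^sup>2 \<le> b * y'\<^sup>2"
    and Q: "\<bar>(a * x\<^sup>2 + b * y\<^sup>2) - (a * x'\<^sup>2 + b * y'\<^sup>2)\<bar> \<le> 2"
  shows "\<bar>y - y'\<bar> \<le> 100 * L"
proof (cases "y = y'")
  case True
  then show ?thesis using L by simp
next
  case False
  then have s: "1 \<le> y + y'" using y by blast
  \<comment> \<open>The slope bound 5 comes from 160 / 9 < 25.\<close>
  have cone': "\<bar>u\<bar> \<le> 5 * v" if "a * u\<^sup>2 \<le> b * v\<^sup>2" "0 \<le> v" for u v
  proof -
    have "9 * u\<^sup>2 \<le> 160 * v\<^sup>2"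
      using that(1) mult_right_mono[OF ab(1), of "u\<^sup>2"] mult_right_mono[OF ab(4), of "v\<^sup>2"] by simp
    then have "u\<^sup>2 \<le> 25 * v\<^sup>2" using zero_le_power2[of v] by linarith
    then have "u\<^sup>2 \<le> (5 * v)\<^sup>2" by (simp add: power_mult_distrib)
    then show ?thesis using abs_le_square_iff[of u "5 * v"] that(2) by simp
  qed
  have "b * (\<bar>y - y'\<bar> * (y + y')) = \<bar>b * (y\<^sup>2 - y'\<^sup>2)\<bar>"
    using ab y by (simp add: abs_mult power2_eq_square square_diff_square_factored mult.commute)
  also have "\<dots> \<le> 2 + \<bar>a * (x\<^sup>2 - x'\<^sup>2)\<bar>"
    using Q by (simp add: right_diff_distrib abs_if split: if_splits)
  also have "\<bar>a * (x\<^sup>2 - x'\<^sup>2)\<bar> = a * (\<bar>x - x'\<bar> * \<bar>x + x'\<bar>)"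
    using ab by (simp add: abs_mult power2_eq_square square_diff_square_factored mult.commute)
  also have "\<dots> \<le> 160 * (L * (5 * (y + y')))"
    using ab L cone'[OF cone(1) y(1)] cone'[OF cone(2) y(2)] y
    by (intro mult_mono) auto
  finally have "b * (\<bar>y - y'\<bar> * (y + y')) \<le> 2 + 160 * (L * (5 * (y + y')))" by simp
  moreover have "9 * (\<bar>y - y'\<bar> * (y + y')) \<le> b * (\<bar>y - y'\<bar> * (y + y'))"
    using ab y by (intro mult_right_mono) auto
  \<comment> \<open>This absorbs the width of the shell: 802 = 160 * 5 + 2, and 802 / 9 <
    100.\<close>
  moreover have "2 \<le> 2 * (L * (y + y'))"
    using L(1) s mult_mono[of 1 L 1 "y + y'"] by simp
  ultimately have "(9 * \<bar>y - y'\<bar>) * (y + y') \<le> (802 * L) * (y + y')"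
    by (simp add: algebra_simps)
  then have "9 * \<bar>y - y'\<bar> \<le> 802 * L"
    using s by (subst (asm) mult_le_cancel_right) auto
  also have "\<dots> \<le> 9 * (100 * L)" using L(1) by simp
  finally show ?thesis by simp
qed

text \<open>Two nearby shell points differ by an almost tangential vector u: Q(p + u) - Q(p) = 2
  B(p, u) + Q(u) is at most 2 in size, while Q(u) = O(L^2).\<close>

lemma shell_tangential:
  fixes a b L u1 u2 x y :: real
  assumes ab: "9 \<le> a" "a \<le> 160" "9 \<le> b" "b \<le> 160" and L: "1 \<le> L"
    and u: "\<bar>u1\<bar> \<le> L" "\<bar>u2\<bar> \<le> 100 * L"
    and Q: "\<bar>(a * x\<^sup>2 + b * y\<^sup>2) - (a * (x + u1)\<^sup>2 + b * (y + u2)\<^sup>2)\<bar> \<le> 2"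
  shows "\<bar>a * x * u1 + b * y * u2\<bar> \<le> 1000000 * L\<^sup>2"
proof -
  have "u1\<^sup>2 \<le> L\<^sup>2" "u2\<^sup>2 \<le> (100 * L)\<^sup>2"
    using power_mono[OF u(1), of 2] power_mono[OF u(2), of 2] by simp_all
  then have "a * u1\<^sup>2 \<le> 160 * L\<^sup>2" "b * u2\<^sup>2 \<le> 160 * (100 * L)\<^sup>2"
    using ab by (intro mult_mono; simp)+
  then have "a * u1\<^sup>2 + b * u2\<^sup>2 \<le> 1600160 * L\<^sup>2"
    by (simp add: power_mult_distrib)
  moreover have "1 \<le> L\<^sup>2" using L by (simp add: one_le_power)
  moreover have "0 \<le> a * u1\<^sup>2 + b * u2\<^sup>2" using ab by simp
  moreover have "(a * (x + u1)\<^sup>2 + b * (y + u2)\<^sup>2) - (a * x\<^sup>2 + b * y\<^sup>2)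
      = 2 * (a * x * u1 + b * y * u2) + (a * u1\<^sup>2 + b * u2\<^sup>2)"
    by (simp add: power2_eq_square algebra_simps)
  then have "\<bar>2 * (a * x * u1 + b * y * u2) + (a * u1\<^sup>2 + b * u2\<^sup>2)\<bar> \<le> 2"
    using Q by (metis abs_minus_commute)
  moreover define B E where "B = a * x * u1 + b * y * u2" and "E = a * u1\<^sup>2 + b * u2\<^sup>2"
  ultimately have "1 \<le> L\<^sup>2" "0 \<le> E" "E \<le> 1600160 * L\<^sup>2" "\<bar>2 * B + E\<bar> \<le> 2" by simp_all
  then have "\<bar>B\<bar> \<le> 1000000 * L\<^sup>2" by linarith
  then show ?thesis by (simp add: B_def)
qed

text \<open>With \<open>p\<close> one of the points, \<open>u\<close>, \<open>v\<close> the differences to the two others and \<open>B\<close> the bilinear form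
  of \<open>Q\<close>, the identity \<open>Q(p) det(u, v) = B(p, u) det(p, v) - B(p, v) det(p, u)\<close> makes the
  integer \<open>det(u, v)\<close> smaller than one. The collinear case contradicts the convexity of \<open>Q\<close>.\<close>

lemma strip_no_three_points:
  fixes a b A L :: real and x1 y1 x2 y2 x3 y3 :: int
  assumes ab: "9 \<le> a" "a \<le> 160" "9 \<le> b" "b \<le> 160" and L: "1 \<le> L" "1000000000 * L ^ 3 \<le> sqrt A"
    and lt: "x1 < x2" "x2 < x3" "of_int (x3 - x1) \<le> L"
    and W: "\<And>x y. (x, y) \<in> {(x1, y1), (x2, y2), (x3, y3)} \<Longrightarrow> 0 \<le> y \<and> a * (of_int x)\<^sup>2 \<le> b * (of_int y)\<^sup>2
      \<and> A \<le> a * (of_int x)\<^sup>2 + b * (of_int y)\<^sup>2 \<and> a * (of_int x)\<^sup>2 + b * (of_int y)\<^sup>2 < A + 2"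
  shows False
proof -
  define q where "q x y = a * (real_of_int x)\<^sup>2 + b * (real_of_int y)\<^sup>2" for x y
  define x y where "x = real_of_int x1" and "y = real_of_int y1"
  define u1 u2 v1 v2 where "u1 = real_of_int (x2 - x1)" and "u2 = real_of_int (y2 - y1)"
    and "v1 = real_of_int (x3 - x1)" and "v2 = real_of_int (y3 - y1)"
  have W1: "0 \<le> y1" "A \<le> q x1 y1" "q x1 y1 < A + 2" "a * (of_int x1)\<^sup>2 \<le> b * (of_int y1)\<^sup>2"
    and W2: "0 \<le> y2" "A \<le> q x2 y2" "q x2 y2 < A + 2" "a * (of_int x2)\<^sup>2 \<le> b * (of_int y2)\<^sup>2"
    and W3: "0 \<le> y3" "A \<le> q x3 y3" "q x3 y3 < A + 2" "a * (of_int x3)\<^sup>2 \<le> b * (of_int y3)\<^sup>2"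
    using W[of x1 y1] W[of x2 y2] W[of x3 y3] by (auto simp: q_def)
  have u1: "0 < u1" "u1 + 1 \<le> v1" "1 \<le> u1" "v1 \<le> L" using lt by (auto simp: u1_def v1_def)
  have "\<bar>real_of_int y2 - real_of_int y1\<bar> \<le> 100 * L"
    by (rule strip_height_diff[OF ab L(1), of "real_of_int x2" "real_of_int x1"])
       (use lt W1 W2 in \<open>auto simp: q_def abs_le_iff\<close>)
  then have u2: "\<bar>u2\<bar> \<le> 100 * L" by (simp add: u2_def)
  have "\<bar>real_of_int y3 - real_of_int y1\<bar> \<le> 100 * L"
    by (rule strip_height_diff[OF ab L(1), of "real_of_int x3" "real_of_int x1"])
       (use lt W1 W3 in \<open>auto simp: q_def abs_le_iff\<close>)
  then have v2: "\<bar>v2\<bar> \<le> 100 * L" by (simp add: v2_def)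
  have Bu: "\<bar>a * x * u1 + b * y * u2\<bar> \<le> 1000000 * L\<^sup>2"
    by (rule shell_tangential[OF ab L(1)])
       (use u1 u2 W1 W2 in \<open>auto simp: q_def u1_def u2_def x_def y_def abs_le_iff\<close>)
  have Bv: "\<bar>a * x * v1 + b * y * v2\<bar> \<le> 1000000 * L\<^sup>2"
    by (rule shell_tangential[OF ab L(1)])
       (use u1 v2 W1 W3 in \<open>auto simp: q_def v1_def v2_def x_def y_def abs_le_iff\<close>)
  have "1 \<le> L ^ 3" using L(1) by (rule one_le_power)
  then have s: "1000000000 \<le> sqrt A" using L(2) by linarith
  then have "(1000000000)\<^sup>2 \<le> (sqrt A)\<^sup>2" by (intro power_mono) auto
  moreover have Apos: "0 \<le> A" using s real_sqrt_ge_0_iff[of A] by linarith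
  ultimately have A: "1000000000 \<le> A" by simp
  have xy: "\<bar>z\<bar> \<le> sqrt A" if "c * z\<^sup>2 < A + 2" "9 \<le> c" for c z :: real
  proof -
    have "9 * z\<^sup>2 \<le> c * z\<^sup>2" using that(2) by (intro mult_right_mono) auto
    then have "z\<^sup>2 \<le> A" using that A by linarith
    then show ?thesis by (metis real_sqrt_abs real_sqrt_le_iff)
  qed
  have xs: "\<bar>x\<bar> \<le> sqrt A" "\<bar>y\<bar> \<le> sqrt A"
  proof -
    have "0 \<le> a * x\<^sup>2" "0 \<le> b * y\<^sup>2" using ab by auto
    then have "a * x\<^sup>2 < A + 2" "b * y\<^sup>2 < A + 2"
      using W1 by (auto simp: q_def x_def y_def)
    then show "\<bar>x\<bar> \<le> sqrt A" "\<bar>y\<bar> \<le> sqrt A" using xy ab by blast+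
  qed
  \<comment> \<open>Crude bounds for the determinants det(p, u) and det(p, v); they exceed L by the
    factor sqrt A, whereas B(p, u) and B(p, v) are free of A.\<close>
  have area: "\<bar>x * t2 - y * t1\<bar> \<le> 101 * L * sqrt A" if "\<bar>t1\<bar> \<le> L" "\<bar>t2\<bar> \<le> 100 * L" for t1 t2
  proof -
    have "\<bar>x * t2 - y * t1\<bar> \<le> \<bar>x\<bar> * \<bar>t2\<bar> + \<bar>y\<bar> * \<bar>t1\<bar>"
      by (metis abs_mult abs_triangle_ineq4)
    also have "\<dots> \<le> sqrt A * (100 * L) + sqrt A * L"
      using xs that Apos by (intro add_mono mult_mono) auto
    finally show ?thesis by (simp add: algebra_simps)
  qed
  define d where "d = (x2 - x1) * (y3 - y1) - (y2 - y1) * (x3 - x1)"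
  have d: "real_of_int d = u1 * v2 - u2 * v1"
    by (simp add: d_def u1_def u2_def v1_def v2_def)
  have "(a * x\<^sup>2 + b * y\<^sup>2) * real_of_int d
      = (a * x * u1 + b * y * u2) * (x * v2 - y * v1) - (a * x * v1 + b * y * v2) * (x * u2 - y * u1)"
    unfolding d by (simp add: power2_eq_square algebra_simps)
  then have "\<bar>(a * x\<^sup>2 + b * y\<^sup>2) * real_of_int d\<bar>
      \<le> \<bar>a * x * u1 + b * y * u2\<bar> * \<bar>x * v2 - y * v1\<bar> + \<bar>a * x * v1 + b * y * v2\<bar> * \<bar>x * u2 - y * u1\<bar>"
    by (metis abs_mult abs_triangle_ineq4)
  also have "\<dots> \<le> (1000000 * L\<^sup>2) * (101 * L * sqrt A) + (1000000 * L\<^sup>2) * (101 * L * sqrt A)"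
    using u1 u2 v2 Bu Bv by (intro add_mono mult_mono area) auto
  also have "\<dots> = (202000000 * L ^ 3) * sqrt A"
    by (simp add: power2_eq_square power3_eq_cube)
  \<comment> \<open>The constant 10^9 in the hypothesis on L leaves room for 2 * 101 * 10^6. Since
    Q(p) is at least A, the integer d has absolute value below one.\<close>
  also have "\<dots> < sqrt A * sqrt A"
  proof (rule mult_strict_right_mono)
    show "202000000 * L ^ 3 < sqrt A" using L(2) \<open>1 \<le> L ^ 3\<close> by linarith
    show "0 < sqrt A" using s by linarith
  qed
  finally have lt_A: "\<bar>(a * x\<^sup>2 + b * y\<^sup>2) * real_of_int d\<bar> < A" using A by simp
  have "d = 0"
  proof (rule ccontr)
    assume "d \<noteq> 0"
    then have "1 \<le> \<bar>real_of_int d\<bar>" by linarith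
    moreover have "A \<le> \<bar>a * x\<^sup>2 + b * y\<^sup>2\<bar>" using W1 by (simp add: q_def x_def y_def)
    ultimately have "A * 1 \<le> \<bar>a * x\<^sup>2 + b * y\<^sup>2\<bar> * \<bar>real_of_int d\<bar>"
      using Apos by (intro mult_mono) auto
    then show False using lt_A by (simp add: abs_mult)
  qed
  then have col: "u2 = u1 * v2 / v1" using d u1 by (simp add: field_simps)
  have q: "q x1 y1 = a * x\<^sup>2 + b * y\<^sup>2" "q x2 y2 = a * (x + u1)\<^sup>2 + b * (y + u2)\<^sup>2"
      "q x3 y3 = a * (x + v1)\<^sup>2 + b * (y + v2)\<^sup>2"
    by (simp_all add: q_def x_def y_def u1_def u2_def v1_def v2_def)
  \<comment> \<open>The second difference of Q along the line through the three points. Confinement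
    to a window of length two allows at most 2 v1, but convexity makes it at least 9 v1, since u1
    and v1 - u1 are at least one and a is at least 9.\<close>
  have "(v1 - u1) * q x1 y1 + u1 * q x3 y3 - v1 * q x2 y2
      = u1 * (v1 - u1) * v1 * a + u1 * (v1 - u1) / v1 * (b * v2\<^sup>2)"
    unfolding q col using u1 by (simp add: field_simps power2_eq_square)
  moreover have "(v1 - u1) * q x1 y1 \<le> (v1 - u1) * (A + 2)" "u1 * q x3 y3 \<le> u1 * (A + 2)"
      "v1 * A \<le> v1 * q x2 y2"
    using u1 W1 W2 W3 by (auto intro!: mult_left_mono)
  moreover have "(v1 - u1) * (A + 2) + u1 * (A + 2) - v1 * A = 2 * v1"
    by (simp add: algebra_simps)
  moreover have "0 \<le> u1 * (v1 - u1) / v1 * (b * v2\<^sup>2)" using u1 ab by simp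
  moreover have "1 * 1 * v1 * 9 \<le> u1 * (v1 - u1) * v1 * a"
    using u1 ab by (intro mult_mono) auto
  ultimately show False using u1 by linarith
qed


lemma card_strip_le_2:
  fixes a b A L :: real
  assumes ab: "9 \<le> a" "a \<le> 160" "9 \<le> b" "b \<le> 160" and L: "1 \<le> L" "1000000000 * L ^ 3 \<le> sqrt A"
    and W: "\<And>x y. (x, y) \<in> W \<Longrightarrow> 0 \<le> y \<and> a * (of_int x)\<^sup>2 \<le> b * (of_int y)\<^sup>2
      \<and> A \<le> a * (of_int x)\<^sup>2 + b * (of_int y)\<^sup>2 \<and> a * (of_int x)\<^sup>2 + b * (of_int y)\<^sup>2 < A + 2"
    and strip: "\<And>p. p \<in> W \<Longrightarrow> \<lfloor>of_int (fst p) / L\<rfloor> = i" and fin: "finite W"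
  shows "card W \<le> 2"
proof (rule ccontr)
  assume "\<not> card W \<le> 2"
  \<comment> \<open>For equal abscissae the squares of the heights differ by less than 2/9, hence
    coincide, and nonnegativity fixes the sign. Three points thus have three distinct
    abscissae.\<close>
  moreover have "inj_on fst W"
  proof (rule inj_onI)
    fix p p' assume p: "p \<in> W" "p' \<in> W" "fst p = fst p'"
    obtain x y y' where xy: "p = (x, y)" "p' = (x, y')" using p by (metis prod.collapse)
    have "\<bar>b * of_int (y\<^sup>2 - y'\<^sup>2)\<bar> < 2"
      using W[of x y] W[of x y'] p by (simp add: xy right_diff_distrib abs_if split: if_splits)
    then have "b * \<bar>of_int (y\<^sup>2 - y'\<^sup>2)\<bar> < 2" using ab by (simp add: abs_mult del: of_int_diff)
    moreover have "9 * \<bar>of_int (y\<^sup>2 - y'\<^sup>2)\<bar> \<le> b * \<bar>of_int (y\<^sup>2 - y'\<^sup>2)\<bar>"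
      using ab by (intro mult_right_mono) auto
    ultimately have "9 * \<bar>real_of_int (y\<^sup>2 - y'\<^sup>2)\<bar> < 2" by (rule le_less_trans[rotated])
    then have "real_of_int \<bar>y\<^sup>2 - y'\<^sup>2\<bar> < 1" unfolding of_int_abs by simp
    then have "\<bar>y\<^sup>2 - y'\<^sup>2\<bar> < 1" by (simp only: of_int_less_1_iff)
    then have "y\<^sup>2 = y'\<^sup>2" by simp
    then show "p = p'" using W[of x y] W[of x y'] p by (simp add: xy)
  qed
  ultimately have c: "3 \<le> card (fst ` W)" by (simp add: card_image)
  define l r where "l = Min (fst ` W)" and "r = Max (fst ` W)"
  have ne: "fst ` W \<noteq> {}" "finite (fst ` W)" using c fin by auto
  have "card {l, r} \<le> 2" by (simp add: card_insert_if)
  then have "\<not> fst ` W \<subseteq> {l, r}" using c card_mono[of "{l, r}" "fst ` W"] by auto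
  then obtain m where m: "m \<in> fst ` W" "m \<noteq> l" "m \<noteq> r" by auto
  have lr: "l \<in> fst ` W" "r \<in> fst ` W" "l \<le> m" "m \<le> r"
    using ne m by (auto simp: l_def r_def)
  obtain y1 y2 y3 where y: "(l, y1) \<in> W" "(m, y2) \<in> W" "(r, y3) \<in> W"
    using m(1) lr(1,2) by force
  have "\<bar>of_int r / L - of_int l / L\<bar> < 1"
    using strip[OF y(1)] strip[OF y(3)] unfolding fst_conv by linarith
  then have "\<bar>of_int (r - l)\<bar> < L" using L(1)
    by (simp add: abs_mult divide_simps flip: diff_divide_distrib)
  then have "of_int (r - l) \<le> L" by simp
  then show False
    by (rule strip_no_three_points[OF ab L, where ?x2.0 = m and ?y1.0 = y1 and ?y2.0 = y2 and ?y3.0 = y3, rotated 2])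
       (use lr m y W in auto)
qed

text \<open>Abscissae on the shell are at most sqrt A in size, so about 2 sqrt A / L strips of width
  L cover this part, and each strip holds at most two points.\<close>

lemma card_cone_shell:
  fixes a b A :: real
  assumes ab: "9 \<le> a" "a \<le> 160" "9 \<le> b" "b \<le> 160" and A: "1000000000 ^ 2 \<le> A"
  shows "real (card {(x, y). {x, y} \<subseteq> {-H..H} \<and> 0 \<le> y \<and> a * (of_int x)\<^sup>2 \<le> b * (of_int y)\<^sup>2
      \<and> A \<le> a * (of_int x)\<^sup>2 + b * (of_int y)\<^sup>2 \<and> a * (of_int x)\<^sup>2 + b * (of_int y)\<^sup>2 < A + 2})
    \<le> 4000 * A powr (1/3) + 6" (is "real (card ?W) \<le> _")
proof -
  \<comment> \<open>The widest strips that \<open>card_strip_le_2\<close> permits: 10^9 L^3 equals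
    sqrt A exactly. The lower bound 10^18 for A gives L >= 1, and the number of strips becomes of
    order A^(1/3).\<close>
  define L where "L = A powr (1/6) / 1000"
  have A0: "0 < A" using A by simp
  have "(1000000000 ^ 2) powr (1/6) \<le> A powr (1/6)" using A by (intro powr_mono2) auto
  moreover have "(1000000000 ^ 2 :: real) powr (1/6) = 1000"
  proof -
    have "(1000000000 ^ 2 :: real) = 1000 powr 6" by (simp add: powr_numeral)
    then show ?thesis by (simp only: powr_powr) simp
  qed
  ultimately have L1: "1 \<le> L" by (simp add: L_def)
  have "(A powr (1/6)) ^ 3 = A powr (1/2)" by (simp add: power3_eq_cube flip: powr_add)
  then have L3: "1000000000 * L ^ 3 = sqrt A"
    using A0 by (simp add: L_def power_divide powr_half_sqrt)
  define m where "m = \<lfloor>sqrt A / L\<rfloor> + 1"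
  have mL: "sqrt A / L = 1000 * A powr (1/3)"
  proof -
    have "A powr (1/3) * A powr (1/6) = sqrt A" using A0 by (simp add: powr_half_sqrt flip: powr_add)
    then show ?thesis using A0 by (simp add: L_def field_simps)
  qed
  have "?W \<subseteq> {-H..H} \<times> {-H..H}" by auto
  then have fin: "finite ?W" by (rule finite_subset) auto
  have idx: "\<lfloor>of_int (fst p) / L\<rfloor> \<in> {-m..m}" if p: "p \<in> ?W" for p
  proof -
    have "0 \<le> b * (of_int (snd p))\<^sup>2" using ab by simp
    moreover have "9 * (of_int (fst p))\<^sup>2 \<le> a * (of_int (fst p))\<^sup>2" using ab by (intro mult_right_mono) auto
    moreover have "a * (of_int (fst p))\<^sup>2 + b * (of_int (snd p))\<^sup>2 < A + 2" using p by auto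
    ultimately have "(real_of_int (fst p))\<^sup>2 \<le> A" using A by simp
    then have "\<bar>real_of_int (fst p)\<bar> \<le> sqrt A" by (metis real_sqrt_abs real_sqrt_le_iff)
    then have "\<bar>real_of_int (fst p) / L\<bar> \<le> sqrt A / L" using L1 by (simp add: divide_right_mono)
    then show ?thesis unfolding m_def atLeastAtMost_iff by linarith
  qed
  let ?S = "\<lambda>i. {p \<in> ?W. \<lfloor>of_int (fst p) / L\<rfloor> = i}"
  have "card ?W \<le> card (\<Union>i\<in>{-m..m}. ?S i)"
  proof (rule card_mono)
    show "finite (\<Union>i\<in>{-m..m}. ?S i)" by (rule finite_subset[OF _ fin]) blast
    show "?W \<subseteq> (\<Union>i\<in>{-m..m}. ?S i)" using idx by blast
  qed
  also have "\<dots> \<le> (\<Sum>i\<in>{-m..m}. card (?S i))" by (rule card_UN_le) auto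
  also have "\<dots> \<le> (\<Sum>i\<in>{-m..m}. 2)"
  proof (rule sum_mono)
    fix i
    show "card (?S i) \<le> 2"
      by (rule card_strip_le_2[OF ab L1, where A = A and i = i]) (use L3 fin in auto)
  qed
  finally have "real (card ?W) \<le> real (2 * nat (2 * m + 1))" by (simp add: mult.commute)
  also have "\<dots> \<le> 4 * (sqrt A / L) + 6"
    using A0 L1 by (simp add: m_def) linarith
  finally show ?thesis by (simp add: mL)
qed

text \<open>The plane is the union of the cone where the y-term dominates and the one where the
  x-term does. Exchanging the coordinates together with a and b maps the second to the first, and
  reflections reduce to nonnegative heights.\<close>

lemma card_binary_window_large:
  fixes a b A :: real
  assumes ab: "9 \<le> a" "a \<le> 160" "9 \<le> b" "b \<le> 160" and A: "1000000000 ^ 2 \<le> A"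
  shows "real (card {(x, y). {x, y} \<subseteq> {-H..H} \<and> A \<le> a * of_int (x\<^sup>2) + b * of_int (y\<^sup>2)
      \<and> a * of_int (x\<^sup>2) + b * of_int (y\<^sup>2) < A + 2})
    \<le> 8 * (4000 * A powr (1/3) + 6)" (is "real (card ?S) \<le> _")
proof -
  define W where "W a b = {(x, y). {x, y} \<subseteq> {-H..H} \<and> 0 \<le> y \<and> a * (of_int x)\<^sup>2 \<le> b * (of_int y)\<^sup>2
      \<and> A \<le> a * (of_int x)\<^sup>2 + b * (of_int y)\<^sup>2 \<and> a * (of_int x)\<^sup>2 + b * (of_int y)\<^sup>2 < A + 2}" for a b
  define h where "h = (\<lambda>(s, x :: int, y :: int). (x, s * y))"
  define h' where "h' = (\<lambda>(s, x :: int, y :: int). (s * y, x))"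
  have finW: "finite (W a b)" for a b
    by (rule finite_subset[of _ "{-H..H} \<times> {-H..H}"]) (auto simp: W_def)
  have sub: "?S \<subseteq> h ` ({1, -1} \<times> W a b) \<union> h' ` ({1, -1} \<times> W b a)"
  proof
    fix p assume "p \<in> ?S"
    then obtain x y where p: "p = (x, y)" and mem: "x \<in> {-H..H}" "y \<in> {-H..H}"
      "A \<le> a * (of_int x)\<^sup>2 + b * (of_int y)\<^sup>2" "a * (of_int x)\<^sup>2 + b * (of_int y)\<^sup>2 < A + 2"
      by auto
    have s: "\<exists>s\<in>{1, -1}. t = s * \<bar>t\<bar>" for t :: int by (cases "0 \<le> t") auto
    show "p \<in> h ` ({1, -1} \<times> W a b) \<union> h' ` ({1, -1} \<times> W b a)"
    proof (cases "a * (real_of_int x)\<^sup>2 \<le> b * (real_of_int y)\<^sup>2")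
      case True
      then have "(x, \<bar>y\<bar>) \<in> W a b" using mem by (auto simp: W_def)
      moreover obtain s where "s \<in> {1, -1}" "y = s * \<bar>y\<bar>" using s by blast
      ultimately show ?thesis unfolding p h_def by (intro UnI1 rev_image_eqI[of "(s, x, \<bar>y\<bar>)"]) auto
    next
      case False
      then have "(y, \<bar>x\<bar>) \<in> W b a" using mem by (auto simp: W_def)
      moreover obtain s where "s \<in> {1, -1}" "x = s * \<bar>x\<bar>" using s by blast
      ultimately show ?thesis unfolding p h'_def by (intro UnI2 rev_image_eqI[of "(s, y, \<bar>x\<bar>)"]) auto
    qed
  qed
  have "card ?S \<le> card (h ` ({1, -1} \<times> W a b) \<union> h' ` ({1, -1} \<times> W b a))"
    using sub finW by (intro card_mono) auto
  also have "\<dots> \<le> card (h ` ({1, -1} \<times> W a b)) + card (h' ` ({1, -1} \<times> W b a))"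
    by (rule card_Un_le)
  also have "\<dots> \<le> card ({1, -1 :: int} \<times> W a b) + card ({1, -1 :: int} \<times> W b a)"
    using finW by (intro add_mono card_image_le) auto
  also have "\<dots> = 2 * card (W a b) + 2 * card (W b a)" by (simp add: card_cartesian_product)
  finally have "real (card ?S) \<le> 2 * real (card (W a b)) + 2 * real (card (W b a))" by linarith
  also have "\<dots> \<le> 2 * (4000 * A powr (1/3) + 6) + 2 * (4000 * A powr (1/3) + 6)"
    unfolding W_def using card_cone_shell[OF ab A, of H] card_cone_shell[OF ab(3,4,1,2) A, of H]
    by (intro add_mono mult_left_mono) auto
  finally show ?thesis by simp
qed

text \<open>For large A a nonempty shell inside the box forces A <= 400 H^2, so A^(1/3) is of order
  H^(2/3). For smaller A the whole shell lies in a fixed box, and its number of points goes into the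
  constant.\<close>

lemma card_binary_window:
  "\<exists>C>0. \<forall>(a::real) b A H. 9 \<le> a \<longrightarrow> a \<le> 160 \<longrightarrow> 9 \<le> b \<longrightarrow> b \<le> 160 \<longrightarrow> 1 \<le> H \<longrightarrow>
    real (card {(x, y). {x, y} \<subseteq> {-H..H} \<and> A \<le> a * of_int (x\<^sup>2) + b * of_int (y\<^sup>2)
      \<and> a * of_int (x\<^sup>2) + b * of_int (y\<^sup>2) < A + 2}) \<le> C * real_of_int H powr (2/3)"
proof -
  \<comment> \<open>Large enough for all (2 * 10^9 + 1)^2 points of the fixed box in the case of
    small A.\<close>
  define C :: real where "C = 10^20"
  have "real (card {(x, y). {x, y} \<subseteq> {-H..H} \<and> A \<le> a * of_int (x\<^sup>2) + b * of_int (y\<^sup>2)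
      \<and> a * of_int (x\<^sup>2) + b * of_int (y\<^sup>2) < A + 2}) \<le> C * real_of_int H powr (2/3)"
    (is "real (card ?S) \<le> _")
    if ab: "9 \<le> a" "a \<le> 160" "9 \<le> b" "b \<le> 160" and H: "1 \<le> H" for a b A :: real and H :: int
  proof -
    have H1: "1 \<le> real_of_int H powr (2/3)" using H by (intro ge_one_powr_ge_zero) auto
    show ?thesis
    proof (cases "1000000000 ^ 2 \<le> A \<and> ?S \<noteq> {}")
      case True
      then obtain x y where xy: "{x, y} \<subseteq> {-H..H}" "A \<le> a * of_int (x\<^sup>2) + b * of_int (y\<^sup>2)" by blast
      have "\<bar>x\<bar> \<le> \<bar>H\<bar>" "\<bar>y\<bar> \<le> \<bar>H\<bar>" using xy(1) by auto
      then have "x\<^sup>2 \<le> H\<^sup>2" "y\<^sup>2 \<le> H\<^sup>2" by (simp_all add: abs_le_square_iff)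
      then have "a * of_int (x\<^sup>2) \<le> 160 * of_int (H\<^sup>2)" "b * of_int (y\<^sup>2) \<le> 160 * of_int (H\<^sup>2)"
        using ab by (intro mult_mono; simp only: of_int_le_iff; simp)+
      moreover have H2: "0 \<le> real_of_int (H\<^sup>2)" by simp
      ultimately have "A \<le> 400 * real_of_int (H\<^sup>2)" using xy(2) H2 by linarith
      then have "A \<le> (20 * real_of_int H)\<^sup>2" by (simp add: power_mult_distrib)
      then have "A powr (1/3) \<le> ((20 * real_of_int H)\<^sup>2) powr (1/3)"
        using True by (intro powr_mono2) auto
      also have "\<dots> = (20 * real_of_int H) powr (2/3)"
      proof -
        have "(20 * real_of_int H)\<^sup>2 = (20 * real_of_int H) powr 2" using H by (simp add: powr_numeral)
        then show ?thesis by (simp only: powr_powr) simp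
      qed
      also have "\<dots> = 20 powr (2/3) * real_of_int H powr (2/3)" using H by (simp add: powr_mult)
      also have "\<dots> \<le> 20 powr 1 * real_of_int H powr (2/3)"
        by (intro mult_right_mono powr_mono) auto
      finally have "A powr (1/3) \<le> 20 * real_of_int H powr (2/3)" by simp
      then have "real (card ?S) \<le> 8 * (4000 * (20 * real_of_int H powr (2/3)) + 6)"
        using card_binary_window_large[OF ab, of A H] True by (intro order_trans[OF card_binary_window_large[OF ab]]) auto
      then show ?thesis using H1 unfolding C_def by simp
    next
      case False
      show ?thesis
      proof (cases "?S = {}")
        case True
        then show ?thesis using H1 by (simp only:) (simp add: C_def)
      next
        case nonempty: False
        define D :: int where "D = 1000000000"
        have "?S \<subseteq> {-D..D} \<times> {-D..D}"
        proof clarify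
          fix x y assume xy: "a * of_int (x\<^sup>2) + b * of_int (y\<^sup>2) < A + 2"
          have "9 * real_of_int (x\<^sup>2) \<le> a * of_int (x\<^sup>2)" "9 * real_of_int (y\<^sup>2) \<le> b * of_int (y\<^sup>2)"
            using ab by (intro mult_right_mono; simp)+
          moreover have "0 \<le> real_of_int (x\<^sup>2)" "0 \<le> real_of_int (y\<^sup>2)" by auto
          moreover have "A < real_of_int (D\<^sup>2)" using False nonempty by (auto simp: D_def)
          moreover have "2 \<le> real_of_int (D\<^sup>2)" by (simp add: D_def)
          ultimately have "real_of_int (x\<^sup>2) \<le> real_of_int (D\<^sup>2)" "real_of_int (y\<^sup>2) \<le> real_of_int (D\<^sup>2)"
            using xy by linarith+
          then have "x\<^sup>2 \<le> D\<^sup>2" "y\<^sup>2 \<le> D\<^sup>2" by (simp_all only: of_int_le_iff)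
          then have "\<bar>x\<bar> \<le> \<bar>D\<bar>" "\<bar>y\<bar> \<le> \<bar>D\<bar>" by (simp_all only: abs_le_square_iff)
          then show "x \<in> {-D..D} \<and> y \<in> {-D..D}" by (auto simp: D_def)
        qed
        then have "card ?S \<le> card ({-D..D} \<times> {-D..D})" by (intro card_mono) auto
        also have "\<dots> = (2 * 1000000000 + 1)\<^sup>2" by (simp add: D_def card_cartesian_product power2_eq_square)
        finally have "real (card ?S) \<le> real ((2 * 1000000000 + 1)\<^sup>2)" by (simp only: of_nat_le_iff)
        also have "\<dots> \<le> C * 1" by (simp add: C_def)
        also have "\<dots> \<le> C * real_of_int H powr (2/3)" using H1 by (intro mult_left_mono) (auto simp: C_def)
        finally show ?thesis .
      qed
    qed
  qed
  moreover have "C > 0" by (simp add: C_def)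
  ultimately show ?thesis by blast
qed

section \<open>Shells in higher dimension\<close>

text \<open>Functions on an arbitrary index set, so that coordinates can be added one at a time;
  extensionality keeps the set finite and its elements determined by their values on J.\<close>

definition shell_points :: "'a set \<Rightarrow> ('a \<Rightarrow> real) \<Rightarrow> int \<Rightarrow> real \<Rightarrow> ('a \<Rightarrow> int) set" where
  "shell_points J \<beta> H A = {x \<in> J \<rightarrow>\<^sub>E {-H..H}. A \<le> (\<Sum>j\<in>J. \<beta> j * of_int ((x j)\<^sup>2)) \<and> (\<Sum>j\<in>J. \<beta> j * of_int ((x j)\<^sup>2)) < A + 2}"

lemma finite_shell_points: "finite J \<Longrightarrow> finite (shell_points J \<beta> H A)"
  by (rule finite_subset[of _ "J \<rightarrow>\<^sub>E {-H..H}"]) (auto simp: shell_points_def intro: finite_PiE)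

lemma shell_points_ext:
  "x \<in> shell_points J \<beta> H A \<Longrightarrow> y \<in> shell_points J \<beta> H A \<Longrightarrow> (\<And>j. j \<in> J \<Longrightarrow> x j = y j) \<Longrightarrow> x = y"
  unfolding shell_points_def by (blast intro: PiE_ext)

text \<open>Fixing the new coordinate to c leaves a shell in the old coordinates with A lowered by a
  multiple of c^2. This is why B has to be uniform in A.\<close>

lemma card_shell_points_insert:
  assumes J: "finite J" "j \<notin> J" and H: "0 \<le> H"
    and B: "\<And>A. real (card (shell_points J \<beta> H A)) \<le> B"
  shows "real (card (shell_points (insert j J) \<beta> H A)) \<le> of_int (2 * H + 1) * B"
proof -
  let ?D = "SIGMA c:{-H..H}. shell_points J \<beta> H (A - \<beta> j * of_int (c\<^sup>2))"
  have "card (shell_points (insert j J) \<beta> H A) \<le> card ?D"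
  proof (rule card_inj_on_le)
    show "inj_on (\<lambda>x. (x j, restrict x J)) (shell_points (insert j J) \<beta> H A)"
    proof (rule inj_onI)
      fix x y assume x: "x \<in> shell_points (insert j J) \<beta> H A" "y \<in> shell_points (insert j J) \<beta> H A"
        and eq: "(x j, restrict x J) = (y j, restrict y J)"
      have "x i = y i" if "i \<in> insert j J" for i
        using eq that by (metis insert_iff prod.inject restrict_apply)
      with x show "x = y" by (rule shell_points_ext)
    qed
    show "(\<lambda>x. (x j, restrict x J)) ` shell_points (insert j J) \<beta> H A \<subseteq> ?D"
      using J by (auto simp: shell_points_def PiE_iff algebra_simps simp del: of_int_power)
    show "finite ?D" using J by (auto intro: finite_shell_points)
  qed
  also have "\<dots> = (\<Sum>c\<in>{-H..H}. card (shell_points J \<beta> H (A - \<beta> j * of_int (c\<^sup>2))))"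
    using J by (intro card_SigmaI) (auto intro: finite_shell_points)
  finally have "real (card (shell_points (insert j J) \<beta> H A))
      \<le> (\<Sum>c\<in>{-H..H}. real (card (shell_points J \<beta> H (A - \<beta> j * of_int (c\<^sup>2)))))"
    by (simp only: of_nat_sum[symmetric] of_nat_le_iff)
  also have "\<dots> \<le> (\<Sum>c\<in>{-H..H}. B)" by (intro sum_mono B)
  also have "\<dots> = of_int (2 * H + 1) * B" using H by simp
  finally show ?thesis .
qed

lemma card_shell_points_union:
  assumes J: "finite J" and D: "finite D" "D \<inter> J = {}" and H: "0 \<le> H"
    and B: "\<And>A. real (card (shell_points J \<beta> H A)) \<le> B"
  shows "real (card (shell_points (D \<union> J) \<beta> H A)) \<le> of_int (2 * H + 1) ^ card D * B"
  using D
proof (induction D arbitrary: A rule: finite_induct)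
  case empty
  then show ?case using B by simp
next
  case (insert j D)
  have "real (card (shell_points (insert j (D \<union> J)) \<beta> H A)) \<le> of_int (2 * H + 1) * (of_int (2 * H + 1) ^ card D * B)"
    by (rule card_shell_points_insert) (use insert J H in auto)
  then show ?case using insert by (simp add: mult.assoc)
qed

lemma card_shell_points_2:
  assumes "a \<noteq> b"
  shows "card (shell_points {a, b} \<beta> H A) \<le> card {(x, y). {x, y} \<subseteq> {-H..H}
    \<and> A \<le> \<beta> a * of_int (x\<^sup>2) + \<beta> b * of_int (y\<^sup>2) \<and> \<beta> a * of_int (x\<^sup>2) + \<beta> b * of_int (y\<^sup>2) < A + 2}"
    (is "_ \<le> card ?S")
proof (rule card_inj_on_le)
  show "inj_on (\<lambda>x. (x a, x b)) (shell_points {a, b} \<beta> H A)"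
    by (rule inj_onI, erule (1) shell_points_ext) auto
  show "(\<lambda>x. (x a, x b)) ` shell_points {a, b} \<beta> H A \<subseteq> ?S"
    using assms by (auto simp: shell_points_def PiE_iff simp del: of_int_power)
  show "finite ?S" by (rule finite_subset[of _ "{-H..H} \<times> {-H..H}"]) auto
qed

lemma card_shell_points_3:
  assumes "distinct [a, b, c]"
  shows "card (shell_points {a, b, c} \<beta> H A) \<le> card {((x, y), z). {x, y, z} \<subseteq> {-H..H}
    \<and> A \<le> \<beta> a * of_int (x\<^sup>2) + \<beta> b * of_int (y\<^sup>2) + \<beta> c * of_int (z\<^sup>2)
    \<and> \<beta> a * of_int (x\<^sup>2) + \<beta> b * of_int (y\<^sup>2) + \<beta> c * of_int (z\<^sup>2) < A + 2}"
    (is "_ \<le> card ?S")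
proof (rule card_inj_on_le)
  show "inj_on (\<lambda>x. ((x a, x b), x c)) (shell_points {a, b, c} \<beta> H A)"
    by (rule inj_onI, erule (1) shell_points_ext) auto
  show "(\<lambda>x. ((x a, x b), x c)) ` shell_points {a, b, c} \<beta> H A \<subseteq> ?S"
    using assms by (auto simp: shell_points_def PiE_iff add.assoc simp del: of_int_power)
  show "finite ?S" by (rule finite_subset[of _ "({-H..H} \<times> {-H..H}) \<times> {-H..H}"]) auto
qed

lemma card_shell_points_4:
  assumes "distinct [a, b, c, d]"
  shows "card (shell_points {a, b, c, d} \<beta> H A) \<le> card {((x, y), (z, w)). {x, y, z, w} \<subseteq> {-H..H}
    \<and> A \<le> \<beta> a * of_int (x\<^sup>2) + \<beta> b * of_int (y\<^sup>2) + \<beta> c * of_int (z\<^sup>2) + \<beta> d * of_int (w\<^sup>2)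
    \<and> \<beta> a * of_int (x\<^sup>2) + \<beta> b * of_int (y\<^sup>2) + \<beta> c * of_int (z\<^sup>2) + \<beta> d * of_int (w\<^sup>2) < A + 2}"
    (is "_ \<le> card ?S")
proof (rule card_inj_on_le)
  show "inj_on (\<lambda>x. ((x a, x b), (x c, x d))) (shell_points {a, b, c, d} \<beta> H A)"
    by (rule inj_onI, erule (1) shell_points_ext) auto
  show "(\<lambda>x. ((x a, x b), (x c, x d))) ` shell_points {a, b, c, d} \<beta> H A \<subseteq> ?S"
    using assms by (auto simp: shell_points_def PiE_iff add.assoc simp del: of_int_power)
  show "finite ?S" by (rule finite_subset[of _ "({-H..H} \<times> {-H..H}) \<times> ({-H..H} \<times> {-H..H})"]) auto
qed

section \<open>Lattice vectors in dimensions two, three and at least four\<close>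

definition lattice_shell :: "('n::finite \<Rightarrow> real) \<Rightarrow> int \<Rightarrow> real \<Rightarrow> (int^'n) set" where
  "lattice_shell \<beta> H A = {l. (\<forall>j. l $ j \<in> {-H..H})
    \<and> A \<le> (\<Sum>j\<in>UNIV. \<beta> j * (of_int (l $ j))\<^sup>2) \<and> (\<Sum>j\<in>UNIV. \<beta> j * (of_int (l $ j))\<^sup>2) < A + 2}"

lemma card_lattice_shell: "card (lattice_shell \<beta> H A) \<le> card (shell_points UNIV \<beta> H A)"
proof (rule card_inj_on_le)
  show "inj_on vec_nth (lattice_shell \<beta> H A)" by (auto simp: inj_on_def vec_nth_inject)
  show "vec_nth ` lattice_shell \<beta> H A \<subseteq> shell_points UNIV \<beta> H A"
    by (auto simp: lattice_shell_def shell_points_def)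
qed (simp add: finite_shell_points)

lemma card_lattice_shell_2:
  assumes d: "CARD('n::finite) = 2" and \<beta>: "\<forall>j. \<beta> j \<in> {9..160}"
  shows "\<exists>C>0. \<forall>H A. 1 \<le> H \<longrightarrow> real (card (lattice_shell (\<beta> :: 'n \<Rightarrow> real) H A)) \<le> C * real_of_int H powr (2/3)"
proof -
  obtain a b :: 'n where ab: "UNIV = {a, b}" "a \<noteq> b"
    using d by (metis card_2_iff)
  obtain C where C: "C > 0" "\<And>(a::real) b A H. 9 \<le> a \<Longrightarrow> a \<le> 160 \<Longrightarrow> 9 \<le> b \<Longrightarrow> b \<le> 160 \<Longrightarrow> 1 \<le> H \<Longrightarrow>
    real (card {(x, y). {x, y} \<subseteq> {-H..H} \<and> A \<le> a * of_int (x\<^sup>2) + b * of_int (y\<^sup>2)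
      \<and> a * of_int (x\<^sup>2) + b * of_int (y\<^sup>2) < A + 2}) \<le> C * real_of_int H powr (2/3)"
    using card_binary_window by blast
  have "real (card (lattice_shell \<beta> H A)) \<le> C * real_of_int H powr (2/3)" if "1 \<le> H" for H A
  proof -
    have "card (lattice_shell \<beta> H A) \<le> card (shell_points {a, b} \<beta> H A)"
      using card_lattice_shell[of \<beta> H A] ab by simp
    also note card_shell_points_2[OF ab(2)]
    finally show ?thesis
      using C(2)[of "\<beta> a" "\<beta> b" H A] \<beta> that by (fastforce intro: order_trans[OF of_nat_mono])
  qed
  then show ?thesis using C(1) by blast
qed

lemma card_lattice_shell_3:
  fixes \<epsilon> :: real
  assumes d: "CARD('n::finite) = 3" and \<beta>: "\<forall>j. \<beta> j \<in> {9..160}" and \<epsilon>: "0 < \<epsilon>"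
  shows "\<exists>C>0. \<forall>H A. 1 \<le> H \<longrightarrow> real (card (lattice_shell (\<beta> :: 'n \<Rightarrow> real) H A)) \<le> C * real_of_int H powr (3/2 + \<epsilon>)"
proof -
  obtain a b c :: 'n where abc: "UNIV = {a, b, c}" "distinct [a, b, c]"
    using d by (auto simp: card_3_iff)
  \<comment> \<open>The loss 2\<epsilon> is halved by the square root below.\<close>
  obtain C where C: "C > 0" "\<And>H. 1 \<le> H \<Longrightarrow> real (square_energy H) \<le> C * real_of_int H powr (2 + 2 * \<epsilon>)"
    using square_energy_bound[of "2 * \<epsilon>"] \<epsilon> by auto
  have "real (card (lattice_shell \<beta> H A)) \<le> (4 * sqrt (24 * C)) * real_of_int H powr (3/2 + \<epsilon>)" if H: "1 \<le> H" for H A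
  proof -
    have \<beta>1: "1 \<le> \<beta> j" for j using \<beta> by (metis atLeastAtMost_iff one_le_numeral order_trans)
    have "card (lattice_shell \<beta> H A) \<le> card (shell_points {a, b, c} \<beta> H A)"
      using card_lattice_shell[of \<beta> H A] abc by simp
    also note card_shell_points_3[OF abc(2)]
    finally have "real (card (lattice_shell \<beta> H A)) \<le> 4 * sqrt (real (4 * square_energy H) * real (2 * nat (2 * H + 1)))"
      by (rule order_trans[OF of_nat_mono card_ternary_window]) (use H \<beta>1 in simp_all)
    also have "\<dots> \<le> 4 * sqrt ((4 * (C * real_of_int H powr (2 + 2 * \<epsilon>))) * (6 * real_of_int H))"
      using C(2)[OF H] H by (intro mult_left_mono real_sqrt_le_mono mult_mono) auto
    also have "(4 * (C * real_of_int H powr (2 + 2 * \<epsilon>))) * (6 * real_of_int H) = (24 * C) * (real_of_int H powr (3/2 + \<epsilon>))\<^sup>2"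
    proof -
      have "(real_of_int H powr (3/2 + \<epsilon>))\<^sup>2 = real_of_int H powr ((2 + 2 * \<epsilon>) + 1)"
        by (simp add: power2_eq_square flip: powr_add)
      also have "\<dots> = real_of_int H powr (2 + 2 * \<epsilon>) * real_of_int H" using H by (subst powr_add) simp
      finally show ?thesis by simp
    qed
    also have "sqrt \<dots> = sqrt (24 * C) * real_of_int H powr (3/2 + \<epsilon>)" by (simp add: real_sqrt_mult)
    finally show ?thesis by simp
  qed
  moreover have "4 * sqrt (24 * C) > 0" using C(1) by simp
  ultimately show ?thesis by blast
qed

text \<open>Four coordinates are counted through the energy of the squares; each of the other d - 4
  runs freely and costs a factor 2H + 1, at most 3H.\<close>

lemma card_lattice_shell_ge_4:
  fixes \<epsilon> :: real
  assumes d: "4 \<le> CARD('n::finite)" and \<beta>: "\<forall>j. \<beta> j \<in> {9..160}" and \<epsilon>: "0 < \<epsilon>"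
  shows "\<exists>C>0. \<forall>H A. 1 \<le> H \<longrightarrow> real (card (lattice_shell (\<beta> :: 'n \<Rightarrow> real) H A))
    \<le> C * real_of_int H powr (real CARD('n) - 2 + \<epsilon>)"
proof -
  obtain K :: "'n set" where "card K = 4" using d obtain_subset_with_card_n by blast
  then obtain a b c e where K: "K = {a, b, c, e}" "distinct [a, b, c, e]"
    by (auto simp: card_Suc_eq eval_nat_numeral)
  obtain C where C: "C > 0" "\<And>H. 1 \<le> H \<Longrightarrow> real (square_energy H) \<le> C * real_of_int H powr (2 + \<epsilon>)"
    using square_energy_bound[OF \<epsilon>] by auto
  define m where "m = CARD('n) - 4"
  have "real (card (lattice_shell \<beta> H A)) \<le> (3 ^ m * (16 * C)) * real_of_int H powr (real CARD('n) - 2 + \<epsilon>)"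
    if H: "1 \<le> H" for H A
  proof -
    have \<beta>1: "1 \<le> \<beta> j" for j using \<beta> by (metis atLeastAtMost_iff one_le_numeral order_trans)
    have "card (- K) = m" using \<open>card K = 4\<close> by (simp add: m_def Compl_eq_Diff_UNIV card_Diff_subset)
    have B: "real (card (shell_points K \<beta> H A)) \<le> 16 * (C * real_of_int H powr (2 + \<epsilon>))" for A
    proof -
      have "real (card (shell_points K \<beta> H A)) \<le> 16 * real (square_energy H)"
        unfolding K(1) by (intro order_trans[OF of_nat_mono[OF card_shell_points_4[OF K(2)]] card_quaternary_window] \<beta>1)
      then show ?thesis using C(2)[OF H] by linarith
    qed
    have "real (card (lattice_shell \<beta> H A)) \<le> real (card (shell_points (- K \<union> K) \<beta> H A))"
      using card_lattice_shell[of \<beta> H A] by simp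
    also have "\<dots> \<le> of_int (2 * H + 1) ^ card (- K) * (16 * (C * real_of_int H powr (2 + \<epsilon>)))"
      by (rule card_shell_points_union) (use B H in auto)
    also have "\<dots> \<le> (3 * real_of_int H) ^ m * (16 * (C * real_of_int H powr (2 + \<epsilon>)))"
      unfolding \<open>card (- K) = m\<close> using H C(1) by (intro mult_right_mono power_mono) auto
    also have "\<dots> = (3 ^ m * (16 * C)) * (real_of_int H powr real m * real_of_int H powr (2 + \<epsilon>))"
      using H by (simp add: power_mult_distrib powr_realpow)
    also have "real_of_int H powr real m * real_of_int H powr (2 + \<epsilon>) = real_of_int H powr (real CARD('n) - 2 + \<epsilon>)"
    proof -
      have "real m + (2 + \<epsilon>) = real CARD('n) - 2 + \<epsilon>" using d by (simp add: m_def of_nat_diff)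
      then show ?thesis by (simp only: powr_add[symmetric])
    qed
    finally show ?thesis .
  qed
  moreover have "3 ^ m * (16 * C) > 0" using C(1) by simp
  ultimately show ?thesis by blast
qed

section \<open>Exponential sums in time\<close>

text \<open>Integration by parts. The weight vanishes at both endpoints, so the boundary terms of
  order 1/s disappear and decay of order 1/x^2 remains.\<close>

lemma has_integral_parabola_cis:
  fixes x T :: real
  assumes "x \<noteq> 0" "0 \<le> T"
  defines "s \<equiv> \<i> * of_real x"
  shows "((\<lambda>t. of_real (T\<^sup>2 - t\<^sup>2) * cis (x * t)) has_integral
    (cis (x * T) * (2 * of_real T / s\<^sup>2 - 2 / s ^ 3) - cis (- x * T) * (- 2 * of_real T / s\<^sup>2 - 2 / s ^ 3))) {-T..T}"
proof -
  have s: "s \<noteq> 0" using assms by (simp add: s_def)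
  define F :: "real \<Rightarrow> complex" where
    "F t = cis (x * t) * (of_real (T\<^sup>2 - t\<^sup>2) / s + 2 * of_real t / s\<^sup>2 - 2 / s ^ 3)" for t
  have "(F has_vector_derivative of_real (T\<^sup>2 - t\<^sup>2) * cis (x * t)) (at t within {-T..T})" for t
  proof -
    have "((\<lambda>z. exp (s * z) * ((of_real (T\<^sup>2) - z\<^sup>2) / s + 2 * z / s\<^sup>2 - 2 / s ^ 3)) has_field_derivative
        (of_real (T\<^sup>2) - (of_real t)\<^sup>2) * exp (s * of_real t)) (at (of_real t))"
      by (rule derivative_eq_intros refl | use s in \<open>simp add: field_simps power2_eq_square power3_eq_cube\<close>)+
    then have "((\<lambda>z. exp (s * z) * ((of_real (T\<^sup>2) - z\<^sup>2) / s + 2 * z / s\<^sup>2 - 2 / s ^ 3)) \<circ> of_real has_vector_derivative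
        (of_real (T\<^sup>2) - (of_real t)\<^sup>2) * exp (s * of_real t)) (at t within {-T..T})"
      using field_vector_diff_chain_at[of "of_real" 1 t] has_vector_derivative_at_within
      by (fastforce intro!: derivative_eq_intros simp: has_vector_derivative_of_real)
    then show ?thesis
      by (simp add: F_def[abs_def] o_def cis_conv_exp s_def mult_ac)
  qed
  then have "((\<lambda>t. of_real (T\<^sup>2 - t\<^sup>2) * cis (x * t)) has_integral (F T - F (- T))) {-T..T}"
    using assms by (intro fundamental_theorem_of_calculus) auto
  then show ?thesis by (simp add: F_def)
qed

text \<open>For |x| < 1 the trivial bound 2 T^3 suffices. Otherwise the explicit integral gives 8 T
  / x^2. The stated bound covers both ranges.\<close>

lemma parabola_transform:
  fixes x T :: real
  assumes T: "1 \<le> T"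
  shows "\<exists>w. ((\<lambda>t. of_real (T\<^sup>2 - t\<^sup>2) * cis (x * t)) has_integral w) {-T..T} \<and> norm w \<le> 16 * T ^ 3 / (1 + x\<^sup>2)"
proof (cases "\<bar>x\<bar> < 1")
  case True
  define w where "w = integral {-T..T} (\<lambda>t. of_real (T\<^sup>2 - t\<^sup>2) * cis (x * t))"
  have w: "((\<lambda>t. of_real (T\<^sup>2 - t\<^sup>2) * cis (x * t)) has_integral w) {-T..T}"
    unfolding w_def by (intro integrable_integral integrable_continuous_real continuous_intros)
  have "norm w \<le> T\<^sup>2 * measure lborel (cbox (-T) T)"
  proof (rule has_integral_bound)
    show "((\<lambda>t. of_real (T\<^sup>2 - t\<^sup>2) * cis (x * t)) has_integral w) (cbox (-T) T)" using w by simp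
    fix t assume "t \<in> cbox (-T) T"
    then have "\<bar>t\<bar> \<le> T" by auto
    then have "t\<^sup>2 \<le> T\<^sup>2" using T by (metis abs_le_square_iff abs_of_nonneg order_trans zero_le_one)
    then show "norm (of_real (T\<^sup>2 - t\<^sup>2) * cis (x * t)) \<le> T\<^sup>2"
      by (simp add: norm_mult flip: of_real_power of_real_diff)
  qed simp
  also have "\<dots> = 2 * T ^ 3" using T by (simp add: power2_eq_square power3_eq_cube)
  also have "\<dots> \<le> 16 * T ^ 3 / (1 + x\<^sup>2)"
  proof -
    have "1 + x\<^sup>2 \<le> 8" using True by (simp add: abs_square_less_1 less_imp_le order_trans[of _ "2::real"])
    then have "(2 * T ^ 3) * (1 + x\<^sup>2) \<le> (2 * T ^ 3) * 8" using T by (intro mult_left_mono) auto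
    then show ?thesis by (simp add: field_simps add_pos_nonneg)
  qed
  finally show ?thesis using w by blast
next
  case False
  then have x: "x \<noteq> 0" "1 \<le> \<bar>x\<bar>" by auto
  define s :: complex where "s = \<i> * of_real x"
  define w where "w = cis (x * T) * (2 * of_real T / s\<^sup>2 - 2 / s ^ 3) - cis (- x * T) * (- 2 * of_real T / s\<^sup>2 - 2 / s ^ 3)"
  have w: "((\<lambda>t. of_real (T\<^sup>2 - t\<^sup>2) * cis (x * t)) has_integral w) {-T..T}"
    unfolding w_def s_def using x T by (intro has_integral_parabola_cis) auto
  have s: "norm s = \<bar>x\<bar>" by (simp add: s_def norm_mult)
  have "norm (2 * of_real T / s\<^sup>2 - 2 / s ^ 3) \<le> 2 * T / x\<^sup>2 + 2 / \<bar>x\<bar> ^ 3"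
    using T by (intro order_trans[OF norm_triangle_ineq4]) (simp add: norm_divide norm_power norm_mult s)
  moreover have "norm (- 2 * of_real T / s\<^sup>2 - 2 / s ^ 3) \<le> 2 * T / x\<^sup>2 + 2 / \<bar>x\<bar> ^ 3"
    using T by (intro order_trans[OF norm_triangle_ineq4]) (simp add: norm_divide norm_power norm_mult s)
  ultimately have "norm w \<le> (2 * T / x\<^sup>2 + 2 / \<bar>x\<bar> ^ 3) + (2 * T / x\<^sup>2 + 2 / \<bar>x\<bar> ^ 3)"
    unfolding w_def by (intro order_trans[OF norm_triangle_ineq4] add_mono) (simp_all add: norm_mult)
  also have "\<dots> \<le> 8 * T / x\<^sup>2"
  proof -
    have "2 / \<bar>x\<bar> ^ 3 = 2 / (\<bar>x\<bar> * x\<^sup>2)" by (simp add: power2_eq_square power3_eq_cube flip: abs_mult)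
    also have "\<dots> \<le> 2 * T / x\<^sup>2"
      using x T mult_mono[of 1 T 1 "\<bar>x\<bar>"] by (simp add: divide_simps)
    finally show ?thesis by simp
  qed
  also have "\<dots> \<le> 16 * T ^ 3 / (1 + x\<^sup>2)"
  proof -
    have x1: "1 \<le> x\<^sup>2" using x by (metis abs_le_square_iff abs_one power_one)
    have T3: "T \<le> T ^ 3" using T power_increasing[of 1 3 T] by simp
    have "T * (1 + x\<^sup>2) \<le> T ^ 3 * (2 * x\<^sup>2)" using x1 T T3 by (intro mult_mono) auto
    then have le: "8 * T * (1 + x\<^sup>2) \<le> 16 * T ^ 3 * x\<^sup>2" by simp
    have "8 * T \<le> 16 * T ^ 3 * x\<^sup>2 / (1 + x\<^sup>2)"
      by (subst pos_le_divide_eq) (use le in \<open>auto simp: add_pos_nonneg\<close>)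
    then show ?thesis using x1 by (subst pos_divide_le_eq) auto
  qed
  finally show ?thesis using w by blast
qed

lemma sum_inverse_quadratic_int_le:
  assumes "finite (F :: int set)"
  shows "(\<Sum>m\<in>F. 1 / (1 + (real_of_int m)\<^sup>2)) \<le> 5"
proof -
  \<comment> \<open>The correction -4 / (n + 1) strengthens the claim enough for induction: it is an
    equality at n = 0, and its increments 4 / ((n + 1) (n + 2)) dominate the two new terms.\<close>
  have sym: "(\<Sum>m\<in>{- int n..int n}. 1 / (1 + (real_of_int m)\<^sup>2)) \<le> 5 - 4 / (real n + 1)" for n
  proof (induction n)
    case 0
    then show ?case by simp
  next
    case (Suc n)
    have "{- int (Suc n)..int (Suc n)} = insert (- int (Suc n)) (insert (int (Suc n)) {- int n..int n})" by auto
    then have "(\<Sum>m\<in>{- int (Suc n)..int (Suc n)}. 1 / (1 + (real_of_int m)\<^sup>2))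
        = 2 / (1 + (real n + 1)\<^sup>2) + (\<Sum>m\<in>{- int n..int n}. 1 / (1 + (real_of_int m)\<^sup>2))"
      by (simp add: add.commute power2_eq_square algebra_simps)
    also have "\<dots> \<le> 2 / (1 + (real n + 1)\<^sup>2) + (5 - 4 / (real n + 1))" using Suc by simp
    also have "\<dots> \<le> 5 - 4 / (real (Suc n) + 1)"
    proof -
      have "2 / X = 4 / (2 * X)" for X :: real by simp
      then have "2 / (1 + (real n + 1)\<^sup>2) = 4 / (2 * (1 + (real n + 1)\<^sup>2))" .
      also have "\<dots> \<le> 4 / ((real n + 1) * (real n + 2))"
        by (intro frac_le) (simp_all add: power2_eq_square algebra_simps add_pos_nonneg)
      also have "\<dots> = 4 / (real n + 1) - 4 / (real n + 2)" by (simp add: field_simps)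
      finally show ?thesis by (simp add: algebra_simps)
    qed
    finally show ?case .
  qed
  obtain n where "F \<subseteq> {- int n..int n}"
  proof
    show "F \<subseteq> {- int (nat (Max (insert 0 (abs ` F))))..int (nat (Max (insert 0 (abs ` F))))}"
    proof
      fix m assume "m \<in> F"
      then have "\<bar>m\<bar> \<le> Max (insert 0 (abs ` F))" using assms by (intro Max_ge) auto
      then show "m \<in> {- int (nat (Max (insert 0 (abs ` F))))..int (nat (Max (insert 0 (abs ` F))))}" by auto
    qed
  qed
  then have "(\<Sum>m\<in>F. 1 / (1 + (real_of_int m)\<^sup>2)) \<le> (\<Sum>m\<in>{- int n..int n}. 1 / (1 + (real_of_int m)\<^sup>2))"
    by (intro sum_mono2) auto
  also have "\<dots> \<le> 5 - 4 / (real n + 1)" by (rule sym)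
  also have "\<dots> \<le> 5" by simp
  finally show ?thesis .
qed

text \<open>Frequencies are grouped by the integer part of \<omega> j - a, with at most M in each
  group. Passing to the integer part costs a factor 3, and the sum over all integers is at most
  5.\<close>

lemma sum_inverse_quadratic_le:
  fixes \<omega> :: "'a \<Rightarrow> real"
  assumes J: "finite J" and M: "\<And>c. real (card {j \<in> J. c \<le> \<omega> j \<and> \<omega> j < c + 1}) \<le> M"
  shows "(\<Sum>j\<in>J. 1 / (1 + (\<omega> j - a)\<^sup>2)) \<le> 15 * M"
proof -
  have M0: "0 \<le> M" using M[of 0] by (rule order_trans[rotated]) simp
  have pt: "1 / (1 + y\<^sup>2) \<le> 3 / (1 + (real_of_int \<lfloor>y\<rfloor>)\<^sup>2)" for y :: real
  proof -
    have gen: "1 + f\<^sup>2 \<le> 3 * (1 + y\<^sup>2)" if "f\<^sup>2 \<le> 2 * y\<^sup>2 + 2" for f :: real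
      using that zero_le_power2[of y] by (simp only: distrib_left)
    have "\<bar>real_of_int \<lfloor>y\<rfloor>\<bar> \<le> \<bar>\<bar>y\<bar> + 1\<bar>" by linarith
    then have "(real_of_int \<lfloor>y\<rfloor>)\<^sup>2 \<le> (\<bar>y\<bar> + 1)\<^sup>2" by (simp only: abs_le_square_iff)
    also have "\<dots> \<le> 2 * y\<^sup>2 + 2"
      using zero_le_power2[of "\<bar>y\<bar> - 1"] by (simp add: power2_eq_square algebra_simps)
    finally have "1 + (real_of_int \<lfloor>y\<rfloor>)\<^sup>2 \<le> 3 * (1 + y\<^sup>2)" using gen by blast
    then show ?thesis by (simp add: field_simps add_pos_nonneg)
  qed
  let ?f = "\<lambda>j. \<lfloor>\<omega> j - a\<rfloor>"
  have "(\<Sum>j\<in>J. 1 / (1 + (\<omega> j - a)\<^sup>2)) \<le> (\<Sum>j\<in>J. 3 / (1 + (real_of_int (?f j))\<^sup>2))"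
    by (intro sum_mono pt)
  also have "\<dots> = (\<Sum>m\<in>?f ` J. \<Sum>j\<in>{j \<in> J. ?f j = m}. 3 / (1 + (real_of_int (?f j))\<^sup>2))"
    using J by (rule sum.image_gen)
  also have "\<dots> \<le> (\<Sum>m\<in>?f ` J. (3 * M) * (1 / (1 + (real_of_int m)\<^sup>2)))"
  proof (rule sum_mono)
    fix m
    have "{j \<in> J. ?f j = m} = {j \<in> J. (a + of_int m) \<le> \<omega> j \<and> \<omega> j < (a + of_int m) + 1}"
      by (auto simp: floor_eq_iff)
    then have c: "real (card {j \<in> J. ?f j = m}) \<le> M" using M by simp
    have "(\<Sum>j\<in>{j \<in> J. ?f j = m}. 3 / (1 + (real_of_int (?f j))\<^sup>2))
        = real (card {j \<in> J. ?f j = m}) * (3 / (1 + (real_of_int m)\<^sup>2))"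
      by simp
    also have "\<dots> \<le> M * (3 / (1 + (real_of_int m)\<^sup>2))" by (intro mult_right_mono c) simp
    finally show "(\<Sum>j\<in>{j \<in> J. ?f j = m}. 3 / (1 + (real_of_int (?f j))\<^sup>2)) \<le> (3 * M) * (1 / (1 + (real_of_int m)\<^sup>2))"
      by (simp add: mult.commute)
  qed
  also have "\<dots> = (3 * M) * (\<Sum>m\<in>?f ` J. 1 / (1 + (real_of_int m)\<^sup>2))" by (simp add: sum_distrib_left)
  also have "\<dots> \<le> (3 * M) * 5" using J M0 by (intro mult_left_mono sum_inverse_quadratic_int_le) auto
  finally show ?thesis by simp
qed

text \<open>The weight \<open>T\<^sup>2 - t\<^sup>2\<close> replaces a sharp cutoff because its Fourier transform is absolutely
  summable over unit windows, so that Schur's test applies to the resulting quadratic form.\<close>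

lemma nn_integral_exponential_sum_le:
  fixes \<omega> :: "'a \<Rightarrow> real" and b :: "'a \<Rightarrow> complex"
  assumes J: "finite J" and M: "\<And>c. real (card {j \<in> J. c \<le> \<omega> j \<and> \<omega> j < c + 1}) \<le> M"
    and T: "2 \<le> T" and I: "I \<in> sets lebesgue" "I \<subseteq> {-T/2..T/2}"
  shows "(\<integral>\<^sup>+t. ennreal ((norm (\<Sum>j\<in>J. b j * cis (- t * \<omega> j)))\<^sup>2) \<partial>lebesgue_on I)
    \<le> ennreal (240 * T ^ 3 * M * (\<Sum>j\<in>J. (norm (b j))\<^sup>2))"
proof -
  define S where "S t = (\<Sum>j\<in>J. b j * cis (- t * \<omega> j))" for t
  have T1: "1 \<le> T" using T by simp
  have "\<forall>x. \<exists>w. ((\<lambda>t. of_real (T\<^sup>2 - t\<^sup>2) * cis (x * t)) has_integral w) {-T..T} \<and> norm w \<le> 16 * T ^ 3 / (1 + x\<^sup>2)"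
    using parabola_transform[OF T1] by blast
  from choice[OF this] obtain w where w: "\<And>x. ((\<lambda>t. of_real (T\<^sup>2 - t\<^sup>2) * cis (x * t)) has_integral w x) {-T..T}"
    and wb: "\<And>x. norm (w x) \<le> 16 * T ^ 3 / (1 + x\<^sup>2)"
    by blast
  \<comment> \<open>Expanding the squared modulus turns the weighted time integral into a quadratic
    form in b whose kernel is the transform of the weight at frequency differences.\<close>
  define V where "V = (\<Sum>j\<in>J. \<Sum>k\<in>J. b j * cnj (b k) * w (\<omega> k - \<omega> j))"
  have "((\<lambda>t. \<Sum>j\<in>J. \<Sum>k\<in>J. b j * cnj (b k) * (of_real (T\<^sup>2 - t\<^sup>2) * cis ((\<omega> k - \<omega> j) * t))) has_integral V) {-T..T}"
    unfolding V_def using J by (intro has_integral_sum has_integral_mult_right w)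
  moreover have "(\<Sum>j\<in>J. \<Sum>k\<in>J. b j * cnj (b k) * (of_real (T\<^sup>2 - t\<^sup>2) * cis ((\<omega> k - \<omega> j) * t)))
      = of_real ((T\<^sup>2 - t\<^sup>2) * (norm (S t))\<^sup>2)" for t
  proof -
    have "of_real ((T\<^sup>2 - t\<^sup>2) * (norm (S t))\<^sup>2) = of_real (T\<^sup>2 - t\<^sup>2) * (S t * cnj (S t))"
      by (simp only: of_real_mult complex_norm_square)
    also have "S t * cnj (S t) = (\<Sum>j\<in>J. \<Sum>k\<in>J. b j * cnj (b k) * cis ((\<omega> k - \<omega> j) * t))"
      unfolding S_def cnj_sum sum_product
      by (intro sum.cong refl) (simp add: cis_cnj cis_mult algebra_simps)
    finally show ?thesis by (simp add: sum_distrib_left algebra_simps)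
  qed
  ultimately have "((\<lambda>t. of_real ((T\<^sup>2 - t\<^sup>2) * (norm (S t))\<^sup>2) :: complex) has_integral V) {-T..T}" by simp
  from has_integral_linear[OF this bounded_linear_Re] have hi: "((\<lambda>t. (T\<^sup>2 - t\<^sup>2) * (norm (S t))\<^sup>2) has_integral Re V) {-T..T}"
    by (simp only: o_def Re_complex_of_real)
  have V: "Re V \<le> 240 * T ^ 3 * M * (\<Sum>j\<in>J. (norm (b j))\<^sup>2)"
  proof -
    \<comment> \<open>Schur's test with a symmetric majorant of the kernel; its row sums are at most
      16 * 15 = 240 times T^3 M.\<close>
    define \<kappa> where "\<kappa> j k = 16 * T ^ 3 / (1 + (\<omega> k - \<omega> j)\<^sup>2)" for j k
    have \<kappa>0: "0 \<le> \<kappa> j k" for j k using T by (simp add: \<kappa>_def)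
    have \<kappa>sym: "\<kappa> j k = \<kappa> k j" for j k by (simp add: \<kappa>_def power2_commute)
    have row: "(\<Sum>k\<in>J. \<kappa> j k) \<le> 240 * T ^ 3 * M" for j
    proof -
      have "(\<Sum>k\<in>J. \<kappa> j k) = 16 * T ^ 3 * (\<Sum>k\<in>J. 1 / (1 + (\<omega> k - \<omega> j)\<^sup>2))"
        by (simp add: \<kappa>_def sum_distrib_left)
      also have "\<dots> \<le> 16 * T ^ 3 * (15 * M)"
        using T by (intro mult_left_mono sum_inverse_quadratic_le J M) auto
      finally show ?thesis by simp
    qed
    have "Re V \<le> norm V" by (rule complex_Re_le_cmod)
    also have "\<dots> \<le> (\<Sum>j\<in>J. \<Sum>k\<in>J. norm (b j * cnj (b k) * w (\<omega> k - \<omega> j)))"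
      unfolding V_def by (intro order_trans[OF norm_sum] sum_mono norm_sum)
    also have "\<dots> \<le> (\<Sum>j\<in>J. \<Sum>k\<in>J. ((norm (b j))\<^sup>2 / 2 + (norm (b k))\<^sup>2 / 2) * \<kappa> j k)"
    proof (intro sum_mono)
      fix j k
      have "norm (b j) * norm (b k) \<le> (norm (b j))\<^sup>2 / 2 + (norm (b k))\<^sup>2 / 2"
        using sum_squares_bound[of "norm (b j)" "norm (b k)"] by simp
      then show "norm (b j * cnj (b k) * w (\<omega> k - \<omega> j)) \<le> ((norm (b j))\<^sup>2 / 2 + (norm (b k))\<^sup>2 / 2) * \<kappa> j k"
        unfolding norm_mult complex_mod_cnj \<kappa>_def by (intro mult_mono wb) auto
    qed
    also have "\<dots> = (\<Sum>j\<in>J. \<Sum>k\<in>J. (norm (b j))\<^sup>2 / 2 * \<kappa> j k) + (\<Sum>j\<in>J. \<Sum>k\<in>J. (norm (b k))\<^sup>2 / 2 * \<kappa> j k)"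
      by (simp add: distrib_right sum.distrib)
    also have "(\<Sum>j\<in>J. \<Sum>k\<in>J. (norm (b k))\<^sup>2 / 2 * \<kappa> j k) = (\<Sum>j\<in>J. \<Sum>k\<in>J. (norm (b j))\<^sup>2 / 2 * \<kappa> j k)"
      by (subst sum.swap) (simp add: \<kappa>sym)
    also have "(\<Sum>j\<in>J. \<Sum>k\<in>J. (norm (b j))\<^sup>2 / 2 * \<kappa> j k) + (\<Sum>j\<in>J. \<Sum>k\<in>J. (norm (b j))\<^sup>2 / 2 * \<kappa> j k)
        = (\<Sum>j\<in>J. (norm (b j))\<^sup>2 * (\<Sum>k\<in>J. \<kappa> j k))"
      unfolding sum_distrib_left by (simp add: mult.commute flip: sum.distrib)
    also have "\<dots> \<le> (\<Sum>j\<in>J. (norm (b j))\<^sup>2 * (240 * T ^ 3 * M))"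
      by (intro sum_mono mult_left_mono row) auto
    also have "\<dots> = 240 * T ^ 3 * M * (\<Sum>j\<in>J. (norm (b j))\<^sup>2)"
      by (simp only: sum_distrib_right[symmetric] mult.commute)
    finally show ?thesis .
  qed
  have "(\<integral>\<^sup>+t. ennreal ((norm (S t))\<^sup>2) \<partial>lebesgue_on I) = (\<integral>\<^sup>+t. ennreal ((norm (S t))\<^sup>2) * indicator I t \<partial>lebesgue)"
    using I by (intro nn_integral_restrict_space) auto
  also have "\<dots> \<le> (\<integral>\<^sup>+t. ennreal ((T\<^sup>2 - t\<^sup>2) * (norm (S t))\<^sup>2) * indicator {-T..T} t \<partial>lebesgue)"
  proof (rule nn_integral_mono)
    fix t
    show "ennreal ((norm (S t))\<^sup>2) * indicator I t \<le> ennreal ((T\<^sup>2 - t\<^sup>2) * (norm (S t))\<^sup>2) * indicator {-T..T} t"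
    proof (cases "t \<in> I")
      case True
      then have "t \<in> {-T/2..T/2}" using I(2) by blast
      then have t: "\<bar>t\<bar> \<le> T / 2" by (auto simp: abs_le_iff)
      then have "t\<^sup>2 \<le> (T / 2)\<^sup>2" using T abs_le_square_iff[of t "T / 2"] by simp
      moreover have "2\<^sup>2 \<le> T\<^sup>2" using T by (intro power_mono) auto
      \<comment> \<open>On I the weight is at least T^2 - T^2 / 4, hence at least 3, so inserting it
        only increases the integral.\<close>
      ultimately have "1 \<le> T\<^sup>2 - t\<^sup>2" by (simp add: power_divide)
      then have "1 * (norm (S t))\<^sup>2 \<le> (T\<^sup>2 - t\<^sup>2) * (norm (S t))\<^sup>2" by (intro mult_right_mono) auto
      moreover have "t \<in> {-T..T}" using t T by auto
      ultimately show ?thesis using True by (simp add: ennreal_leI)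
    qed simp
  qed
  also have "\<dots> = (\<integral>\<^sup>+t. ennreal ((T\<^sup>2 - t\<^sup>2) * (norm (S t))\<^sup>2) * indicator {-T..T} t \<partial>lborel)"
    by (simp add: nn_integral_completion)
  also have "\<dots> = ennreal (Re V)"
  proof (rule nn_integral_has_integral_lebesgue'[OF _ hi])
    fix t assume "t \<in> {-T..T}"
    then have "t\<^sup>2 \<le> T\<^sup>2" using abs_le_square_iff[of t T] by auto
    then show "0 \<le> (T\<^sup>2 - t\<^sup>2) * (norm (S t))\<^sup>2" by simp
  qed
  also have "\<dots> \<le> ennreal (240 * T ^ 3 * M * (\<Sum>j\<in>J. (norm (b j))\<^sup>2))" by (rule ennreal_leI[OF V])
  finally show ?thesis by (simp add: S_def)
qed

section \<open>Fourier analysis on the torus\<close>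

text \<open>Fubini for product functions: Lebesgue measure is the image of the product measure
  indexed by \<open>Basis\<close>, and the basis vectors \<open>axis j 1\<close> are reindexed by
  j.\<close>

lemma integral_lborel_prod:
  fixes h :: "'n::finite \<Rightarrow> real \<Rightarrow> complex"
  assumes h: "\<And>j. integrable lborel (h j)"
  shows "(\<integral>x. (\<Prod>j\<in>UNIV. h j (x $ j)) \<partial>(lborel :: (real^'n) measure)) = (\<Prod>j\<in>UNIV. \<integral>x. h j x \<partial>lborel)"
proof -
  interpret product_sigma_finite "\<lambda>_ :: real^'n. lborel :: real measure" ..
  have [measurable]: "h j \<in> borel_measurable borel" for j using h[of j] by auto
  have Basis: "(Basis :: (real^'n) set) = (\<lambda>i. axis i 1) ` UNIV" by (auto simp: Basis_vec_def)
  have inj: "inj (\<lambda>i :: 'n. axis i (1 :: real))" by (auto simp: inj_on_def axis_eq_axis)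
  have comp: "(\<Sum>b\<in>Basis. f b *\<^sub>R b) $ j = f (axis j 1)" for f :: "real^'n \<Rightarrow> real" and j
  proof -
    have ax: "axis i (1 :: real) $ j = (if i = j then 1 else 0)" for i by (simp add: axis_def)
    have "(\<Sum>b\<in>Basis. f b *\<^sub>R b) $ j = (\<Sum>i\<in>UNIV. f (axis i 1) * (if i = j then 1 else 0))"
      by (simp only: sum_component vector_scaleR_component Basis sum.reindex[OF inj] o_def ax real_scaleR_def)
    then show ?thesis by (simp add: if_distrib cong: if_cong)
  qed
  have "(\<integral>x. (\<Prod>j\<in>UNIV. h j (x $ j)) \<partial>(lborel :: (real^'n) measure))
      = (\<integral>f. (\<Prod>j\<in>UNIV. h j (f (axis j 1))) \<partial>(\<Pi>\<^sub>M b\<in>(Basis :: (real^'n) set). lborel))"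
    by (subst lborel_eq, subst integral_distr) (simp_all add: comp del: sum_component vector_scaleR_component)
  also have "\<dots> = (\<integral>f. (\<Prod>b\<in>Basis. h (axis_index b) (f b)) \<partial>(\<Pi>\<^sub>M b\<in>(Basis :: (real^'n) set). lborel))"
    by (simp add: Basis prod.reindex[OF inj])
  also have "\<dots> = (\<Prod>b\<in>(Basis :: (real^'n) set). \<integral>x. h (axis_index b) x \<partial>lborel)"
    by (rule product_integral_prod) (auto simp: h)
  also have "\<dots> = (\<Prod>j\<in>UNIV. \<integral>x. h j x \<partial>lborel)"
    by (simp add: Basis prod.reindex[OF inj])
  finally show ?thesis .
qed

lemma integral_cis_period:
  fixes a :: real
  assumes a: "0 < a"
  shows "has_bochner_integral lborel (\<lambda>x. indicator {0..<a} x *\<^sub>R cis (2 * pi * (of_int m * x / a))) (if m = 0 then of_real a else 0)"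
proof -
  define F :: "real \<Rightarrow> complex" where
    "F x = (if m = 0 then of_real x else cis (2 * pi * (of_int m * x / a)) / (\<i> * of_real (2 * pi * of_int m / a)))" for x
  have "(F has_vector_derivative cis (2 * pi * (of_int m * x / a))) (at x within S)" for x S
  proof (cases "m = 0")
    case True
    then show ?thesis using bounded_linear.has_vector_derivative[OF bounded_linear_of_real has_vector_derivative_id]
      by (simp add: F_def[abs_def])
  next
    case False
    define s :: complex where "s = \<i> * of_real (2 * pi * of_int m / a)"
    have s: "s \<noteq> 0" using False a by (simp add: s_def)
    have c: "cis (2 * pi * (of_int m * x / a)) = exp (s * of_real x)" for x
      by (simp add: s_def cis_conv_exp mult_ac)
    have "((\<lambda>x. exp (s * of_real x) / s) has_vector_derivative exp (s * of_real x)) (at x within S)"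
      by (rule has_vector_derivative_real_field[where f = "\<lambda>z. exp (s * z) / s"])
         (use s in \<open>auto intro!: derivative_eq_intros\<close>)
    moreover have "F = (\<lambda>x. exp (s * of_real x) / s)"
      unfolding F_def[abs_def] by (simp only: c False if_False) (simp only: s_def)
    ultimately show ?thesis by (simp only: c)
  qed
  then have "has_bochner_integral lborel (\<lambda>x. indicator {0..a} x *\<^sub>R cis (2 * pi * (of_int m * x / a))) (F a - F 0)"
    using a by (intro has_bochner_integral_FTC_Icc continuous_intros) auto
  moreover have "F a - F 0 = (if m = 0 then of_real a else 0)"
    using a by (simp add: F_def cis_multiple_2pi)
  \<comment> \<open>The fundamental theorem of calculus uses the closed interval, the fundamental
    box the half-open one; they differ by one point.\<close>
  moreover have "AE x in lborel. indicator {0..a} x *\<^sub>R cis (2 * pi * (of_int m * x / a))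
      = indicator {0..<a} x *\<^sub>R cis (2 * pi * (of_int m * x / a))"
    using AE_lborel_singleton[of a] by eventually_elim (auto simp: indicator_def)
  moreover have "cis \<in> borel_measurable borel"
    by (intro borel_measurable_continuous_onI continuous_on_cis continuous_on_id)
  then have [measurable]: "(\<lambda>x. indicator A x *\<^sub>R cis (2 * pi * (of_int m * x / a))) \<in> borel_measurable lborel"
    if "A \<in> sets borel" for A :: "real set"
    using that by measurable
  ultimately show ?thesis
    using has_bochner_integral_cong_AE[THEN iffD1, of "\<lambda>x. indicator {0..a} x *\<^sub>R cis (2 * pi * (of_int m * x / a))"
        lborel "\<lambda>x. indicator {0..<a} x *\<^sub>R cis (2 * pi * (of_int m * x / a))"] by simp
qed

lemma fundamental_box_sets [measurable, simp]: "fundamental_box \<alpha> \<in> sets borel"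
proof -
  have "fundamental_box \<alpha> = (\<Inter>j. {x. 0 \<le> x $ j} \<inter> {x. x $ j < \<alpha> $ j})"
    by (auto simp: fundamental_box_def)
  also have "\<dots> \<in> sets borel" by measurable
  finally show ?thesis .
qed

definition torus_volume :: "real^'n::finite \<Rightarrow> real" where
  "torus_volume \<alpha> = (\<Prod>j\<in>UNIV. \<alpha> $ j)"

lemma indicator_fundamental_box:
  "indicator (fundamental_box \<alpha>) x = (\<Prod>j\<in>UNIV. indicator {0..<\<alpha> $ j} (x $ j) :: real)"
  by (auto simp: indicator_def fundamental_box_def prod_eq_1_iff split: if_splits)

lemma cis_sum: "finite A \<Longrightarrow> cis (sum f A) = (\<Prod>a\<in>A. cis (f a))"
  by (induction A rule: finite_induct) (auto simp: cis_mult[symmetric])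

lemma torus_char_prod: "torus_char \<alpha> n x = (\<Prod>j\<in>UNIV. cis (2 * pi * (of_int (n $ j) * x $ j / \<alpha> $ j)))"
  by (simp add: torus_char_def sum_distrib_left cis_sum)

lemma torus_char_borel [measurable]: "torus_char \<alpha> n \<in> borel_measurable borel"
proof -
  have "continuous_on UNIV (torus_char \<alpha> n)"
    unfolding torus_char_def[abs_def] divide_inverse by (intro continuous_intros)
  then show ?thesis by (rule borel_measurable_continuous_onI)
qed

lemma integral_torus_char:
  assumes \<alpha>: "\<forall>j. 0 < \<alpha> $ j"
  shows "(\<integral>x. torus_char \<alpha> n x \<partial>torus \<alpha>) = (if n = 0 then of_real (torus_volume \<alpha>) else 0)"
proof -
  define h :: "'a \<Rightarrow> real \<Rightarrow> complex" where
    "h j y = indicator {0..<\<alpha> $ j} y *\<^sub>R cis (2 * pi * (of_int (n $ j) * y / \<alpha> $ j))" for j y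
  have hb: "has_bochner_integral lborel (h j) (if n $ j = 0 then of_real (\<alpha> $ j) else 0)" for j
    unfolding h_def using \<alpha> by (intro integral_cis_period) auto
  have "(\<integral>x. torus_char \<alpha> n x \<partial>torus \<alpha>) = (\<integral>x. indicator (fundamental_box \<alpha>) x *\<^sub>R torus_char \<alpha> n x \<partial>lebesgue)"
    by (rule integral_restrict_space) simp
  also have "\<dots> = (\<integral>x. indicator (fundamental_box \<alpha>) x *\<^sub>R torus_char \<alpha> n x \<partial>lborel)"
    by (rule integral_completion) measurable
  also have "\<dots> = (\<integral>x. (\<Prod>j\<in>UNIV. h j (x $ j)) \<partial>lborel)"
    by (simp add: h_def indicator_fundamental_box torus_char_prod scaleR_conv_of_real prod.distrib)
  also have "\<dots> = (\<Prod>j\<in>UNIV. \<integral>x. h j x \<partial>lborel)"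
    using hb by (intro integral_lborel_prod) (auto simp: has_bochner_integral_iff)
  also have "\<dots> = (\<Prod>j\<in>UNIV. if n $ j = 0 then of_real (\<alpha> $ j) else 0)"
    using hb by (simp add: has_bochner_integral_iff)
  also have "\<dots> = (if n = 0 then of_real (torus_volume \<alpha>) else 0)"
    by (auto simp: torus_volume_def vec_eq_iff)
  finally show ?thesis .
qed

lemma torus_char_mult: "torus_char \<alpha> n x * torus_char \<alpha> m x = torus_char \<alpha> (n + m) x"
  by (simp add: torus_char_def cis_mult sum.distrib add_divide_distrib algebra_simps)

lemma torus_char_cnj: "cnj (torus_char \<alpha> n x) = torus_char \<alpha> (- n) x"
  by (simp add: torus_char_def cis_cnj sum_negf)

lemma norm_torus_char [simp]: "norm (torus_char \<alpha> n x) = 1"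
  by (simp add: torus_char_def)

lemma torus_char_mult_cnj: "torus_char \<alpha> n x * cnj (torus_char \<alpha> m x) = torus_char \<alpha> (n - m) x"
  by (simp add: torus_char_cnj torus_char_mult)

lemma torus_char_measurable [measurable]: "torus_char \<alpha> n \<in> borel_measurable (torus \<alpha>)"
  by (rule measurable_restrict_space1) (simp add: torus_char_borel measurable_completion)

lemma finite_measure_torus: "finite_measure (torus \<alpha>)"
proof
  have "bounded (fundamental_box \<alpha>)"
    by (rule bounded_subset[OF bounded_cbox[of 0 \<alpha>]]) (auto simp: fundamental_box_def mem_box_cart, metis less_imp_le)
  then have "fundamental_box \<alpha> \<in> lmeasurable"
    by (intro bounded_set_imp_lmeasurable) auto
  then show "emeasure (torus \<alpha>) (space (torus \<alpha>)) \<noteq> \<infinity>"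
    by (simp add: space_restrict_space emeasure_restrict_space fmeasurable_def less_top[symmetric])
qed

lemma integrable_torus_bounded:
  fixes g :: "real^'n::finite \<Rightarrow> complex"
  assumes "g \<in> borel_measurable (torus \<alpha>)" "\<And>x. norm (g x) \<le> B"
  shows "integrable (torus \<alpha>) g"
  using assms by (intro finite_measure.integrable_const_bound[OF finite_measure_torus]) auto

lemma integrable_torus_char: "integrable (torus \<alpha>) (torus_char \<alpha> n)"
  by (rule integrable_torus_bounded[where B = 1]) auto

lemma torus_parseval:
  assumes \<alpha>: "\<forall>j. 0 < \<alpha> $ j" and S: "finite S"
  shows "(\<integral>\<^sup>+x. ennreal ((norm (\<Sum>n\<in>S. c n * torus_char \<alpha> n x))\<^sup>2) \<partial>torus \<alpha>)
    = ennreal (torus_volume \<alpha> * (\<Sum>n\<in>S. (norm (c n))\<^sup>2))"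
proof -
  let ?P = "\<lambda>x. \<Sum>n\<in>S. c n * torus_char \<alpha> n x"
  have bound: "norm (?P x) \<le> (\<Sum>n\<in>S. norm (c n))" for x
    by (intro order_trans[OF norm_sum] sum_mono) (simp add: norm_mult)
  have sq: "of_real ((norm (?P x))\<^sup>2) = (\<Sum>n\<in>S. \<Sum>m\<in>S. c n * cnj (c m) * torus_char \<alpha> (n - m) x)" for x
  proof -
    have "of_real ((norm (?P x))\<^sup>2) = (\<Sum>n\<in>S. \<Sum>m\<in>S. (c n * torus_char \<alpha> n x) * cnj (c m * torus_char \<alpha> m x))"
      by (simp only: complex_norm_square cnj_sum sum_product)
    also have "\<dots> = (\<Sum>n\<in>S. \<Sum>m\<in>S. c n * cnj (c m) * torus_char \<alpha> (n - m) x)"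
      by (intro sum.cong refl) (simp add: torus_char_mult_cnj[symmetric] mult_ac)
    finally show ?thesis .
  qed
  have int: "integrable (torus \<alpha>) (\<lambda>x. (norm (?P x))\<^sup>2)"
  proof (rule finite_measure.integrable_const_bound[OF finite_measure_torus, where B = "(\<Sum>n\<in>S. norm (c n))\<^sup>2"])
    show "AE x in torus \<alpha>. norm ((norm (?P x))\<^sup>2) \<le> (\<Sum>n\<in>S. norm (c n))\<^sup>2"
      using bound by (intro AE_I2) (simp add: power_mono)
  qed measurable
  have "of_real (\<integral>x. (norm (?P x))\<^sup>2 \<partial>torus \<alpha>) = (\<integral>x. of_real ((norm (?P x))\<^sup>2) \<partial>torus \<alpha> :: complex)"
    by (rule integral_complex_of_real[symmetric])
  also have "\<dots> = (\<Sum>n\<in>S. \<Sum>m\<in>S. c n * cnj (c m) * (\<integral>x. torus_char \<alpha> (n - m) x \<partial>torus \<alpha>))"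
    unfolding sq by (simp add: integrable_torus_char)
  also have "\<dots> = (\<Sum>n\<in>S. \<Sum>m\<in>S. if m = n then of_real ((norm (c n))\<^sup>2 * torus_volume \<alpha>) else 0)"
    unfolding integral_torus_char[OF \<alpha>] by (intro sum.cong refl) (auto simp: complex_norm_square simp del: of_real_power)
  also have "\<dots> = of_real (torus_volume \<alpha> * (\<Sum>n\<in>S. (norm (c n))\<^sup>2))"
    using S by (simp add: sum_distrib_left mult.commute)
  finally have "(\<integral>x. (norm (?P x))\<^sup>2 \<partial>torus \<alpha>) = torus_volume \<alpha> * (\<Sum>n\<in>S. (norm (c n))\<^sup>2)"
    by (simp only: of_real_eq_iff)
  then show ?thesis using nn_integral_eq_integral[OF int] by simp
qed

text \<open>The fourth power of the modulus of P is the squared modulus of P^2, and P^2 is again a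
  trigonometric polynomial, whose k-th coefficient collects the pairs with sum k.\<close>

lemma torus_L4_parseval:
  assumes \<alpha>: "\<forall>j. 0 < \<alpha> $ j" and S: "finite S"
  shows "(\<integral>\<^sup>+x. ennreal (norm (\<Sum>n\<in>S. c n * torus_char \<alpha> n x) ^ 4) \<partial>torus \<alpha>)
    = ennreal (torus_volume \<alpha> * (\<Sum>k\<in>(\<lambda>p. fst p + snd p) ` (S \<times> S).
        (norm (\<Sum>p\<in>{p \<in> S \<times> S. fst p + snd p = k}. c (fst p) * c (snd p)))\<^sup>2))"
proof -
  let ?K = "(\<lambda>p. fst p + snd p) ` (S \<times> S)"
  let ?c = "\<lambda>k. \<Sum>p\<in>{p \<in> S \<times> S. fst p + snd p = k}. c (fst p) * c (snd p)"
  have "norm (\<Sum>n\<in>S. c n * torus_char \<alpha> n x) ^ 4 = (norm (\<Sum>k\<in>?K. ?c k * torus_char \<alpha> k x))\<^sup>2" for x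
  proof -
    have "(\<Sum>n\<in>S. c n * torus_char \<alpha> n x)\<^sup>2
        = (\<Sum>p\<in>S \<times> S. c (fst p) * c (snd p) * torus_char \<alpha> (fst p + snd p) x)"
      by (simp add: power2_eq_square sum_product sum.cartesian_product torus_char_mult[symmetric] case_prod_unfold mult_ac)
    also have "\<dots> = (\<Sum>k\<in>?K. \<Sum>p\<in>{p \<in> S \<times> S. fst p + snd p = k}. c (fst p) * c (snd p) * torus_char \<alpha> (fst p + snd p) x)"
      using S by (intro sum.image_gen) auto
    also have "\<dots> = (\<Sum>k\<in>?K. ?c k * torus_char \<alpha> k x)"
      unfolding sum_distrib_right by (intro sum.cong refl) auto
    finally have "(\<Sum>n\<in>S. c n * torus_char \<alpha> n x)\<^sup>2 = (\<Sum>k\<in>?K. ?c k * torus_char \<alpha> k x)" .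
    moreover have "norm z ^ 4 = (norm (z\<^sup>2))\<^sup>2" for z :: complex
      by (simp add: norm_power flip: power_mult)
    ultimately show ?thesis by (simp only:)
  qed
  then show ?thesis using torus_parseval[OF \<alpha>, of ?K ?c] S by simp
qed

lemma ennreal_root_power:
  assumes "0 < p"
  shows "ennreal_root p x ^ p = x"
proof (cases x)
  case (real r)
  then show ?thesis using assms by (simp add: ennreal_root_def ennreal_power)
next
  case top
  then show ?thesis using assms by (simp add: ennreal_root_def)
qed

lemma torus_norm_power:
  assumes "0 < p"
  shows "torus_norm p \<alpha> g ^ p = (\<integral>\<^sup>+x. ennreal (norm (g x) ^ p) \<partial>torus \<alpha>)"
  by (simp add: Lp_norm_def ennreal_root_power[OF assms] ennreal_power)

lemma torus_volume_pos: "\<forall>j. 0 < \<alpha> $ j \<Longrightarrow> 0 < torus_volume \<alpha>"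
  unfolding torus_volume_def by (intro prod_pos) auto

text \<open>Bessel's inequality: expand the nonnegative integral of |f - P|^2, where P is the
  partial Fourier sum. The integrals of Re (f cnj P) and of |P|^2 both equal the left-hand
  side.\<close>

lemma torus_bessel:
  assumes \<alpha>: "\<forall>j. 0 < \<alpha> $ j" and S: "finite S" and f: "f \<in> torus_L2 \<alpha>"
  shows "ennreal (torus_volume \<alpha> * (\<Sum>n\<in>S. (norm (fourier_coeff \<alpha> f n))\<^sup>2)) \<le> (torus_norm 2 \<alpha> f)\<^sup>2"
proof -
  interpret finite_measure "torus \<alpha>" by (rule finite_measure_torus)
  have V: "0 < torus_volume \<alpha>" by (rule torus_volume_pos[OF \<alpha>])
  define a where "a n = fourier_coeff \<alpha> f n" for n
  define P where "P x = (\<Sum>n\<in>S. a n * torus_char \<alpha> n x)" for x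
  have [measurable]: "f \<in> borel_measurable (torus \<alpha>)"
    using f by (auto simp: torus_L2_def intro: measurable_restrict_space1)
  have [measurable]: "P \<in> borel_measurable (torus \<alpha>)"
    unfolding P_def by measurable
  have norm_f: "(torus_norm 2 \<alpha> f)\<^sup>2 = (\<integral>\<^sup>+x. ennreal ((norm (f x))\<^sup>2) \<partial>torus \<alpha>)"
    by (rule torus_norm_power) simp
  have "(torus_norm 2 \<alpha> f)\<^sup>2 < \<infinity>"
    using f by (simp add: torus_L2_def power_less_top_ennreal)
  then have f2: "integrable (torus \<alpha>) (\<lambda>x. (norm (f x))\<^sup>2)"
    unfolding norm_f by (intro integrableI_bounded) auto
  \<comment> \<open>On a space of finite measure square integrability implies integrability, through
    |f| <= 1 + |f|^2.\<close>
  have f1: "integrable (torus \<alpha>) f"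
  proof (rule Bochner_Integration.integrable_bound)
    show "integrable (torus \<alpha>) (\<lambda>x. 1 + (norm (f x))\<^sup>2)" using f2 by simp
    have "norm (f x) \<le> 1 + (norm (f x))\<^sup>2" for x
    proof -
      have "2 * norm (f x) \<le> 1 + (norm (f x))\<^sup>2"
        using zero_le_power2[of "norm (f x) - 1"] by (simp add: power2_diff)
      then show ?thesis using norm_ge_zero[of "f x"] by linarith
    qed
    then show "AE x in torus \<alpha>. norm (f x) \<le> norm (1 + (norm (f x))\<^sup>2)" by (intro AE_I2) (simp add: abs_of_nonneg)
  qed measurable
  have fe: "integrable (torus \<alpha>) (\<lambda>x. f x * cnj (torus_char \<alpha> n x))" for n
    unfolding torus_char_cnj
    by (rule Bochner_Integration.integrable_bound[OF f1], measurable) (simp add: norm_mult)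
  have fP: "integrable (torus \<alpha>) (\<lambda>x. f x * cnj (P x))"
  proof -
    have "f x * cnj (P x) = (\<Sum>n\<in>S. cnj (a n) * (f x * cnj (torus_char \<alpha> n x)))" for x
      by (simp add: P_def sum_distrib_left mult_ac)
    then show ?thesis using fe by simp
  qed
  have intfe: "(\<integral>x. f x * cnj (torus_char \<alpha> n x) \<partial>torus \<alpha>) = of_real (torus_volume \<alpha>) * a n" for n
  proof -
    have "complex_of_real (\<Prod>j\<in>UNIV. \<alpha> $ j) \<noteq> 0" using V unfolding torus_volume_def of_real_eq_0_iff
      by (rule less_imp_neq[symmetric])
    then show ?thesis
      by (simp only: a_def fourier_coeff_def torus_volume_def times_divide_eq_right nonzero_mult_div_cancel_left not_False_eq_True)
  qed
  have "(\<integral>x. f x * cnj (P x) \<partial>torus \<alpha>) = (\<integral>x. (\<Sum>n\<in>S. cnj (a n) * (f x * cnj (torus_char \<alpha> n x))) \<partial>torus \<alpha>)"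
    by (simp add: P_def sum_distrib_left mult_ac)
  also have "\<dots> = (\<Sum>n\<in>S. cnj (a n) * (of_real (torus_volume \<alpha>) * a n))"
    using fe by (simp add: intfe)
  also have "\<dots> = of_real (torus_volume \<alpha> * (\<Sum>n\<in>S. (norm (a n))\<^sup>2))"
    unfolding of_real_mult of_real_sum complex_norm_square sum_distrib_left by (intro sum.cong refl) (simp add: mult_ac)
  finally have fPval: "(\<integral>x. f x * cnj (P x) \<partial>torus \<alpha>) = of_real (torus_volume \<alpha> * (\<Sum>n\<in>S. (norm (a n))\<^sup>2))" .
  have ReP: "(\<integral>x. Re (f x * cnj (P x)) \<partial>torus \<alpha>) = torus_volume \<alpha> * (\<Sum>n\<in>S. (norm (a n))\<^sup>2)"
    using integral_Re[OF fP] fPval by (simp only: Re_complex_of_real)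
  have P2nn: "(\<integral>\<^sup>+x. ennreal ((norm (P x))\<^sup>2) \<partial>torus \<alpha>) = ennreal (torus_volume \<alpha> * (\<Sum>n\<in>S. (norm (a n))\<^sup>2))"
    unfolding P_def by (rule torus_parseval[OF \<alpha> S])
  have P2: "integrable (torus \<alpha>) (\<lambda>x. (norm (P x))\<^sup>2)"
    using P2nn by (intro integrableI_bounded) auto
  have P2val: "(\<integral>x. (norm (P x))\<^sup>2 \<partial>torus \<alpha>) = torus_volume \<alpha> * (\<Sum>n\<in>S. (norm (a n))\<^sup>2)"
    using P2nn V by (intro integral_eq_nn_integral[THEN trans]) (auto simp: sum_nonneg)
  define h where "h x = Re (f x * cnj (P x))" for x
  have hi: "integrable (torus \<alpha>) h" unfolding h_def by (rule integrable_Re[OF fP])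
  have "0 \<le> (\<integral>x. (norm (f x - P x))\<^sup>2 \<partial>torus \<alpha>)" by simp
  also have "\<dots> = (\<integral>x. (norm (f x))\<^sup>2 - 2 * h x + (norm (P x))\<^sup>2 \<partial>torus \<alpha>)"
  proof (rule Bochner_Integration.integral_cong)
    fix x
    have "(norm (u - v))\<^sup>2 = (norm u)\<^sup>2 - 2 * Re (u * cnj v) + (norm v)\<^sup>2" for u v :: complex
      unfolding cmod_power2 by (simp add: power2_eq_square algebra_simps)
    then show "(norm (f x - P x))\<^sup>2 = (norm (f x))\<^sup>2 - 2 * h x + (norm (P x))\<^sup>2" by (simp only: h_def)
  qed simp
  also have "\<dots> = (\<integral>x. (norm (f x))\<^sup>2 \<partial>torus \<alpha>) - 2 * (\<integral>x. h x \<partial>torus \<alpha>) + (\<integral>x. (norm (P x))\<^sup>2 \<partial>torus \<alpha>)"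
    using f2 P2 hi by simp
  finally have "torus_volume \<alpha> * (\<Sum>n\<in>S. (norm (a n))\<^sup>2) \<le> (\<integral>x. (norm (f x))\<^sup>2 \<partial>torus \<alpha>)"
    unfolding h_def ReP P2val by simp
  then have "ennreal (torus_volume \<alpha> * (\<Sum>n\<in>S. (norm (a n))\<^sup>2)) \<le> ennreal (\<integral>x. (norm (f x))\<^sup>2 \<partial>torus \<alpha>)"
    by (rule ennreal_leI)
  also have "\<dots> = (torus_norm 2 \<alpha> f)\<^sup>2"
    unfolding norm_f using f2 by (intro nn_integral_eq_integral[symmetric]) auto
  finally show ?thesis by (simp only: a_def)
qed

lemma torus_char_periodic: "\<forall>j. 0 < \<alpha> $ j \<Longrightarrow> torus_char \<alpha> n (x + axis j (\<alpha> $ j)) = torus_char \<alpha> n x"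
proof -
  assume \<alpha>: "\<forall>j. 0 < \<alpha> $ j"
  have "(\<Sum>i\<in>UNIV. of_int (n $ i) * (x + axis j (\<alpha> $ j)) $ i / \<alpha> $ i)
      = (\<Sum>i\<in>UNIV. of_int (n $ i) * x $ i / \<alpha> $ i + (if i = j then of_int (n $ j) else 0))"
    using \<alpha> by (intro sum.cong refl) (auto simp: axis_def field_simps less_imp_neq[symmetric])
  also have "\<dots> = (\<Sum>i\<in>UNIV. of_int (n $ i) * x $ i / \<alpha> $ i) + of_int (n $ j)"
    by (simp add: sum.distrib)
  finally show ?thesis
    by (simp add: torus_char_def distrib_left cis_mult[symmetric] cis_multiple_2pi)
qed

section \<open>The Schrodinger group on functions with finite spectrum\<close>

lemma schrodinger_sum_eq:
  assumes "finite S" "spectrum \<alpha> f \<subseteq> S" "S \<subseteq> F" "finite F"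
  shows "schrodinger_sum \<alpha> t f F = schrodinger_sum \<alpha> t f S"
  unfolding schrodinger_sum_def[abs_def]
  by (intro ext sum.mono_neutral_right) (use assms in \<open>auto simp: spectrum_def\<close>)

lemma schrodinger_sum_L2:
  assumes \<alpha>: "\<forall>j. 0 < \<alpha> $ j" and S: "finite S"
  shows "schrodinger_sum \<alpha> t f S \<in> torus_L2 \<alpha>"
proof -
  let ?P = "schrodinger_sum \<alpha> t f S"
  have "?P \<in> borel_measurable borel"
    unfolding schrodinger_sum_def[abs_def]
    by (intro borel_measurable_sum borel_measurable_times borel_measurable_const torus_char_borel)
  then have "?P \<in> borel_measurable lebesgue" by (intro measurable_completion) simp
  moreover have "torus_periodic \<alpha> ?P"
    unfolding torus_periodic_def schrodinger_sum_def using torus_char_periodic[OF \<alpha>] by simp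
  moreover have "(torus_norm 2 \<alpha> ?P)\<^sup>2 < \<infinity>"
    unfolding torus_norm_power[OF zero_less_numeral] schrodinger_sum_def torus_parseval[OF \<alpha> S] by simp
  then have "torus_norm 2 \<alpha> ?P < \<infinity>" by (simp add: power_less_top_ennreal)
  ultimately show ?thesis by (simp add: torus_L2_def)
qed

text \<open>With finite spectrum the partial sums are constant once the index set contains S. This
  makes the sum over S an admissible choice, and any other admissible choice is at L2 distance zero
  from it.\<close>

lemma schrodinger_AE:
  assumes \<alpha>: "\<forall>j. 0 < \<alpha> $ j" and S: "finite S" and f: "spectrum \<alpha> f \<subseteq> S"
  shows "AE x in torus \<alpha>. schrodinger \<alpha> t f x = schrodinger_sum \<alpha> t f S x"
proof -
  let ?P = "schrodinger_sum \<alpha> t f S"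
  let ?C = "\<lambda>g. g \<in> torus_L2 \<alpha> \<and> ((\<lambda>F. torus_norm 2 \<alpha> (\<lambda>x. g x - schrodinger_sum \<alpha> t f F x)) \<longlongrightarrow> 0)
       (finite_subsets_at_top UNIV)"
  have ev: "\<forall>\<^sub>F F in finite_subsets_at_top UNIV. torus_norm 2 \<alpha> (\<lambda>x. g x - schrodinger_sum \<alpha> t f F x)
      = torus_norm 2 \<alpha> (\<lambda>x. g x - ?P x)" for g
    unfolding eventually_finite_subsets_at_top
  proof (intro exI conjI allI impI)
    fix F :: "(int^'a) set" assume "finite F \<and> S \<subseteq> F \<and> F \<subseteq> UNIV"
    then have "schrodinger_sum \<alpha> t f F = ?P" using schrodinger_sum_eq[OF S f] by blast
    then show "torus_norm 2 \<alpha> (\<lambda>x. g x - schrodinger_sum \<alpha> t f F x) = torus_norm 2 \<alpha> (\<lambda>x. g x - ?P x)"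
      by (simp only:)
  qed (use S in auto)
  have "?C ?P"
  proof
    show "?P \<in> torus_L2 \<alpha>" by (rule schrodinger_sum_L2[OF \<alpha> S])
    have "torus_norm 2 \<alpha> (\<lambda>x. ?P x - ?P x) = 0"
      by (simp add: Lp_norm_def ennreal_root_def)
    then show "((\<lambda>F. torus_norm 2 \<alpha> (\<lambda>x. ?P x - schrodinger_sum \<alpha> t f F x)) \<longlongrightarrow> 0) (finite_subsets_at_top UNIV)"
      using ev[of ?P] by (intro tendsto_eventually) simp
  qed
  then have C: "?C (schrodinger \<alpha> t f)" unfolding schrodinger_def by (rule someI[of ?C])
  let ?D = "\<lambda>x. schrodinger \<alpha> t f x - ?P x"
  have "((\<lambda>F. torus_norm 2 \<alpha> (\<lambda>x. schrodinger \<alpha> t f x - schrodinger_sum \<alpha> t f F x)) \<longlongrightarrow> torus_norm 2 \<alpha> ?D)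
      (finite_subsets_at_top UNIV)"
    using ev by (rule tendsto_eventually)
  then have "torus_norm 2 \<alpha> ?D = 0"
    using C tendsto_unique[OF finite_subsets_at_top_neq_bot] by blast
  then have "(\<integral>\<^sup>+x. ennreal ((norm (?D x))\<^sup>2) \<partial>torus \<alpha>) = 0"
    using torus_norm_power[of 2 \<alpha> ?D] by simp
  moreover have "schrodinger \<alpha> t f \<in> borel_measurable (torus \<alpha>)"
    using C by (auto simp: torus_L2_def intro: measurable_restrict_space1)
  moreover have "?P \<in> borel_measurable (torus \<alpha>)"
    unfolding schrodinger_sum_def[abs_def]
    by (intro borel_measurable_sum borel_measurable_times borel_measurable_const torus_char_measurable)
  ultimately show ?thesis by (subst (asm) nn_integral_0_iff_AE) auto
qed

section \<open>The Strichartz estimate\<close>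

lemma finite_int_box: "finite {n :: int^'n::finite. \<forall>j. n $ j \<in> {-N..N}}"
proof (rule finite_imageD)
  show "finite (vec_nth ` {n :: int^'n. \<forall>j. n $ j \<in> {-N..N}})"
    by (rule finite_subset[of _ "UNIV \<rightarrow>\<^sub>E {-N..N}"]) (auto intro: finite_PiE)
qed (auto simp: inj_on_def vec_nth_inject)

section \<open>From counts of frequency pairs to the space-time norm\<close>

definition laplace_weight :: "real^'n::finite \<Rightarrow> 'n \<Rightarrow> real" where
  "laplace_weight \<alpha> j = 4 * pi\<^sup>2 / (\<alpha> $ j)\<^sup>2"

lemma laplace_eigenvalue_eq: "laplace_eigenvalue \<alpha> n = (\<Sum>j\<in>UNIV. laplace_weight \<alpha> j * (of_int (n $ j))\<^sup>2)"
  by (simp add: laplace_eigenvalue_def laplace_weight_def sum_distrib_left power_divide)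

text \<open>The weight ranges between pi^2 and 16 pi^2, and pi^2 lies between 9 and 10. This is the
  origin of the bounds 9 and 160 in all the counting lemmas.\<close>

lemma laplace_weight_bounds:
  assumes "\<alpha> $ j \<in> {1/2..2}"
  shows "laplace_weight \<alpha> j \<in> {9..160}"
proof -
  have a: "1/2 \<le> \<alpha> $ j" "\<alpha> $ j \<le> 2" using assms by auto
  have a2: "(1/2)\<^sup>2 \<le> (\<alpha> $ j)\<^sup>2" "(\<alpha> $ j)\<^sup>2 \<le> 2\<^sup>2" 
    using power_mono[OF a(1), of 2] power_mono[OF a(2), of 2] a(1) by simp_all
  have "3\<^sup>2 \<le> pi\<^sup>2" using pi_gt3 by (intro power_mono) auto
  moreover have "pi\<^sup>2 \<le> (315/100)\<^sup>2" using pi_approx(2) pi_ge_zero by (intro power_mono) auto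
  ultimately have p: "9 \<le> pi\<^sup>2" "pi\<^sup>2 \<le> 10" by (auto simp: power2_eq_square)
  have pos: "0 < (\<alpha> $ j)\<^sup>2" using a by simp
  have "9 * (\<alpha> $ j)\<^sup>2 \<le> 9 * 4" "160 * (1/4) \<le> 160 * (\<alpha> $ j)\<^sup>2"
    using a2 by (simp_all add: power2_eq_square)
  then have "9 * (\<alpha> $ j)\<^sup>2 \<le> 4 * pi\<^sup>2" "4 * pi\<^sup>2 \<le> 160 * (\<alpha> $ j)\<^sup>2" using p by linarith+
  then show ?thesis using pos by (simp add: laplace_weight_def field_simps)
qed

lemma laplace_eigenvalue_parallelogram:
  "laplace_eigenvalue \<alpha> (n - m) = 2 * (laplace_eigenvalue \<alpha> n + laplace_eigenvalue \<alpha> m) - laplace_eigenvalue \<alpha> (n + m)"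
  unfolding laplace_eigenvalue_eq sum_distrib_left sum.distrib[symmetric] sum_subtractf[symmetric]
  by (intro sum.cong refl) (simp add: power2_eq_square algebra_simps)

text \<open>For a fixed sum k the difference n - m determines the pair. The parallelogram law turns
  a window of length one for the sum of the eigenvalues into one of length two for the eigenvalue of
  n - m, and the box doubles to 2N.\<close>

lemma card_sum_window_le_lattice_shell:
  fixes S :: "(int^'n::finite) set"
  assumes S: "S \<subseteq> {n. \<forall>j. n $ j \<in> {-N..N}}"
  shows "card {p \<in> {p \<in> S \<times> S. fst p + snd p = k}.
      c \<le> laplace_eigenvalue \<alpha> (fst p) + laplace_eigenvalue \<alpha> (snd p)
      \<and> laplace_eigenvalue \<alpha> (fst p) + laplace_eigenvalue \<alpha> (snd p) < c + 1}
    \<le> card (lattice_shell (laplace_weight \<alpha>) (2 * N) (2 * c - laplace_eigenvalue \<alpha> k))"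
    (is "card ?P \<le> card ?L")
proof (rule card_inj_on_le)
  show "inj_on (\<lambda>p. fst p - snd p) ?P"
  proof (rule inj_onI)
    fix p q assume "p \<in> ?P" "q \<in> ?P" and d: "fst p - snd p = fst q - snd q"
    then have s: "fst p + snd p = fst q + snd q" by simp
    have "2 * (fst p $ j) = 2 * (fst q $ j)" "2 * (snd p $ j) = 2 * (snd q $ j)" for j
      using arg_cong[OF d, of "\<lambda>v. v $ j"] arg_cong[OF s, of "\<lambda>v. v $ j"] by simp_all
    then have "fst p = fst q" "snd p = snd q" by (simp_all add: vec_eq_iff)
    then show "p = q" by (rule prod_eqI)
  qed
  show "(\<lambda>p. fst p - snd p) ` ?P \<subseteq> ?L"
  proof
    fix l assume "l \<in> (\<lambda>p. fst p - snd p) ` ?P"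
    then obtain n m where l: "l = n - m" and nm: "n \<in> S" "m \<in> S" "n + m = k"
      "c \<le> laplace_eigenvalue \<alpha> n + laplace_eigenvalue \<alpha> m"
      "laplace_eigenvalue \<alpha> n + laplace_eigenvalue \<alpha> m < c + 1" by auto
    have "n $ j \<in> {-N..N}" "m $ j \<in> {-N..N}" for j using nm S by auto
    then have "(n - m) $ j \<in> {-(2 * N)..2 * N}" for j
      by (simp only: vector_minus_component atLeastAtMost_iff) (smt (verit))
    moreover have "laplace_eigenvalue \<alpha> (n - m) = 2 * (laplace_eigenvalue \<alpha> n + laplace_eigenvalue \<alpha> m) - laplace_eigenvalue \<alpha> k"
      using laplace_eigenvalue_parallelogram[of \<alpha> n m] nm by simp
    ultimately show "l \<in> ?L"
      unfolding lattice_shell_def l laplace_eigenvalue_eq[symmetric] using nm by simp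
  qed
  show "finite ?L"
    by (rule finite_subset[OF _ finite_int_box[of "2 * N"]]) (auto simp: lattice_shell_def)
qed

lemma ennreal_root_4_le:
  assumes "X \<le> ennreal r" "0 \<le> r"
  shows "(ennreal_root 4 X)\<^sup>2 \<le> ennreal (sqrt r)"
proof (cases X)
  case (real x)
  have "((root 4 x)\<^sup>2)\<^sup>2 = x" using real by (simp flip: power_mult)
  then have "(root 4 x)\<^sup>2 = sqrt x" by (metis real_sqrt_unique zero_le_power2)
  also have "\<dots> \<le> sqrt r" using assms real by simp
  finally have "ennreal ((root 4 x)\<^sup>2) \<le> ennreal (sqrt r)" by (rule ennreal_leI)
  then show ?thesis using real by (simp add: ennreal_root_def ennreal_power)
next
  case top
  then show ?thesis using assms by (simp add: top_unique)
qed

text \<open>At each time \<open>torus_L4_parseval\<close> gives a sum over k of squared exponential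
  sums in t. Each is integrated separately at the cost of M, and the results are summed over k;
  Bessel's inequality then brings in the norm of f.\<close>

lemma schrodinger_L4_le:
  fixes \<alpha> :: "real^'n::finite"
  assumes \<alpha>: "\<forall>j. 0 < \<alpha> $ j" and T: "2 \<le> T" and I: "I \<in> sets lebesgue" "I \<subseteq> {-T/2..T/2}"
    and M: "\<And>A. real (card (lattice_shell (laplace_weight \<alpha>) (2 * N) A)) \<le> M"
    and f: "f \<in> torus_L2 \<alpha>" "spectrum \<alpha> f \<subseteq> {n. \<forall>j. n $ j \<in> {-N..N}}"
  shows "(strichartz_norm 4 4 I \<alpha> f)\<^sup>2 \<le> ennreal (sqrt (240 * T ^ 3 * M / torus_volume \<alpha>)) * (torus_norm 2 \<alpha> f)\<^sup>2"
proof -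
  define S where "S = {n :: int^'n. \<forall>j. n $ j \<in> {-N..N}}"
  have S: "finite S" unfolding S_def by (rule finite_int_box)
  define a where "a n = fourier_coeff \<alpha> f n" for n
  define V where "V = torus_volume \<alpha>"
  have V: "0 < V" unfolding V_def by (rule torus_volume_pos[OF \<alpha>])
  define K where "K = (\<lambda>p. fst p + snd p) ` (S \<times> S)"
  define D where "D k = {p \<in> S \<times> S. fst p + snd p = k}" for k
  define \<omega> where "\<omega> p = laplace_eigenvalue \<alpha> (fst p) + laplace_eigenvalue \<alpha> (snd p)" for p
  define b where "b p = a (fst p) * a (snd p)" for p
  define Z where "Z k t = (norm (\<Sum>p\<in>D k. b p * cis (- t * \<omega> p)))\<^sup>2" for k t
  have M0: "0 \<le> M" using M[of 0] by (rule order_trans[rotated]) simp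
  have finD: "finite (D k)" for k using S by (simp add: D_def)
  have L4: "torus_norm 4 \<alpha> (schrodinger \<alpha> t f) ^ 4 = ennreal (V * (\<Sum>k\<in>K. Z k t))" for t
  proof -
    have ae: "AE x in torus \<alpha>. schrodinger \<alpha> t f x = schrodinger_sum \<alpha> t f S x"
      using f S by (intro schrodinger_AE[OF \<alpha>]) (auto simp: S_def)
    have "torus_norm 4 \<alpha> (schrodinger \<alpha> t f) ^ 4 = (\<integral>\<^sup>+x. ennreal (norm (schrodinger \<alpha> t f x) ^ 4) \<partial>torus \<alpha>)"
      by (rule torus_norm_power) simp
    also have "\<dots> = (\<integral>\<^sup>+x. ennreal (norm (\<Sum>n\<in>S. (cis (- t * laplace_eigenvalue \<alpha> n) * a n) * torus_char \<alpha> n x) ^ 4) \<partial>torus \<alpha>)"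
      using ae by (intro nn_integral_cong_AE) (auto simp: schrodinger_sum_def a_def elim!: eventually_mono)
    also have "\<dots> = ennreal (V * (\<Sum>k\<in>K. (norm (\<Sum>p\<in>D k. (cis (- t * laplace_eigenvalue \<alpha> (fst p)) * a (fst p))
        * (cis (- t * laplace_eigenvalue \<alpha> (snd p)) * a (snd p))))\<^sup>2))"
      unfolding V_def K_def D_def by (rule torus_L4_parseval[OF \<alpha> S])
    also have "\<dots> = ennreal (V * (\<Sum>k\<in>K. Z k t))"
    proof -
      have "(cis (- t * laplace_eigenvalue \<alpha> (fst p)) * a (fst p)) * (cis (- t * laplace_eigenvalue \<alpha> (snd p)) * a (snd p))
          = b p * cis (- t * \<omega> p)" for p
      proof -
        have "cis (- t * \<omega> p) = cis (- t * laplace_eigenvalue \<alpha> (fst p)) * cis (- t * laplace_eigenvalue \<alpha> (snd p))"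
          by (simp add: \<omega>_def cis_mult algebra_simps)
        then show ?thesis by (simp add: b_def mult_ac)
      qed
      then show ?thesis by (simp only: Z_def)
    qed
    finally show ?thesis .
  qed
  have Zmeas: "(\<lambda>t. ennreal (Z k t)) \<in> borel_measurable (lebesgue_on I)" for k
  proof -
    have "continuous_on UNIV (Z k)" unfolding Z_def[abs_def] by (intro continuous_intros)
    then have "Z k \<in> borel_measurable borel" by (rule borel_measurable_continuous_onI)
    then have "Z k \<in> borel_measurable (lebesgue_on I)"
      by (intro measurable_restrict_space1 measurable_completion) simp
    then show ?thesis by measurable
  qed
  have "(\<integral>\<^sup>+t. torus_norm 4 \<alpha> (schrodinger \<alpha> t f) ^ 4 \<partial>lebesgue_on I)
      = (\<integral>\<^sup>+t. ennreal V * (\<Sum>k\<in>K. ennreal (Z k t)) \<partial>lebesgue_on I)"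
    unfolding L4 using V by (intro nn_integral_cong) (simp add: ennreal_mult Z_def sum_nonneg)
  also have "\<dots> = ennreal V * (\<Sum>k\<in>K. \<integral>\<^sup>+t. ennreal (Z k t) \<partial>lebesgue_on I)"
    using Zmeas by (simp add: nn_integral_cmult nn_integral_sum)
  also have "\<dots> \<le> ennreal V * (\<Sum>k\<in>K. ennreal (240 * T ^ 3 * M * (\<Sum>p\<in>D k. (norm (b p))\<^sup>2)))"
  proof (intro mult_left_mono sum_mono)
    fix k
    show "(\<integral>\<^sup>+t. ennreal (Z k t) \<partial>lebesgue_on I) \<le> ennreal (240 * T ^ 3 * M * (\<Sum>p\<in>D k. (norm (b p))\<^sup>2))"
      unfolding Z_def
    proof (rule nn_integral_exponential_sum_le[OF finD _ T I])
      fix c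
      have "card {p \<in> D k. c \<le> \<omega> p \<and> \<omega> p < c + 1}
          \<le> card (lattice_shell (laplace_weight \<alpha>) (2 * N) (2 * c - laplace_eigenvalue \<alpha> k))"
        unfolding D_def \<omega>_def by (rule card_sum_window_le_lattice_shell) (simp add: S_def)
      then show "real (card {p \<in> D k. c \<le> \<omega> p \<and> \<omega> p < c + 1}) \<le> M"
        using M order_trans of_nat_mono by blast
    qed
  qed simp
  also have "\<dots> = ennreal (V * (240 * T ^ 3 * M * (\<Sum>n\<in>S. (norm (a n))\<^sup>2)\<^sup>2))"
  proof -
    \<comment> \<open>The sets \<open>D k\<close> partition the pairs, and the coefficients
      \<open>b p\<close> are products, so the double sum factors into a square.\<close>
    have "(\<Sum>k\<in>K. \<Sum>p\<in>D k. (norm (b p))\<^sup>2) = (\<Sum>p\<in>S \<times> S. (norm (b p))\<^sup>2)"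
      unfolding K_def D_def using S by (intro sum.image_gen[symmetric]) auto
    also have "\<dots> = (\<Sum>n\<in>S. (norm (a n))\<^sup>2)\<^sup>2"
      by (simp add: b_def norm_mult power_mult_distrib power2_eq_square[of "sum _ _"] sum_product sum.cartesian_product case_prod_unfold)
    finally have "(\<Sum>k\<in>K. 240 * T ^ 3 * M * (\<Sum>p\<in>D k. (norm (b p))\<^sup>2)) = 240 * T ^ 3 * M * (\<Sum>n\<in>S. (norm (a n))\<^sup>2)\<^sup>2"
      by (simp only: sum_distrib_left[symmetric])
    moreover have "0 \<le> 240 * T ^ 3 * M * (\<Sum>p\<in>D k. (norm (b p))\<^sup>2)" for k
      using T M0 by (intro mult_nonneg_nonneg sum_nonneg) auto
    ultimately show ?thesis using V by (simp add: sum_ennreal ennreal_mult' del: ennreal_mult)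
  qed
  finally have time: "(\<integral>\<^sup>+t. torus_norm 4 \<alpha> (schrodinger \<alpha> t f) ^ 4 \<partial>lebesgue_on I)
      \<le> ennreal (V * (240 * T ^ 3 * M * (\<Sum>n\<in>S. (norm (a n))\<^sup>2)\<^sup>2))" .
  have "(strichartz_norm 4 4 I \<alpha> f)\<^sup>2 \<le> ennreal (sqrt (V * (240 * T ^ 3 * M * (\<Sum>n\<in>S. (norm (a n))\<^sup>2)\<^sup>2)))"
    unfolding strichartz_norm_def Lp_norm_def[of 4 "lebesgue_on I"]
    using V T M0 by (intro ennreal_root_4_le[OF time]) auto
  \<comment> \<open>One factor V comes from Parseval in space; Bessel's inequality for the squared
    coefficient sum calls for V^2, hence the quotient M / V.\<close>
  also have "sqrt (V * (240 * T ^ 3 * M * (\<Sum>n\<in>S. (norm (a n))\<^sup>2)\<^sup>2))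
      = sqrt (240 * T ^ 3 * M / V) * (V * (\<Sum>n\<in>S. (norm (a n))\<^sup>2))"
  proof -
    have "V * (240 * T ^ 3 * M * (\<Sum>n\<in>S. (norm (a n))\<^sup>2)\<^sup>2)
        = (240 * T ^ 3 * M / V) * (V * (\<Sum>n\<in>S. (norm (a n))\<^sup>2))\<^sup>2"
      using V by (simp add: power2_eq_square)
    moreover have "0 \<le> V * (\<Sum>n\<in>S. (norm (a n))\<^sup>2)" using V by (intro mult_nonneg_nonneg sum_nonneg) auto
    ultimately show ?thesis by (simp only: real_sqrt_mult real_sqrt_abs abs_of_nonneg)
  qed
  also have "ennreal \<dots> = ennreal (sqrt (240 * T ^ 3 * M / V)) * ennreal (V * (\<Sum>n\<in>S. (norm (a n))\<^sup>2))"
    using V T M0 by (intro ennreal_mult) (auto intro!: mult_nonneg_nonneg sum_nonneg divide_nonneg_nonneg)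
  also have "\<dots> \<le> ennreal (sqrt (240 * T ^ 3 * M / V)) * (torus_norm 2 \<alpha> f)\<^sup>2"
    unfolding a_def V_def by (intro mult_left_mono torus_bessel[OF \<alpha> S f(1)]) simp
  finally show ?thesis by (simp only: V_def)
qed

text \<open>The constant in \<open>schrodinger_L4_le\<close> is of order sqrt M, so a count with
  exponent \<kappa> yields the exponent \<kappa>/2 for the squared norm; since N >= 1 it may be
  raised to \<gamma>.\<close>

lemma strichartz_of_lattice_count:
  fixes \<alpha> :: "real^'n::finite"
  assumes \<alpha>: "\<forall>j. \<alpha> $ j \<in> {1/2..2}" and I: "is_interval I" "bounded I"
    and count: "\<exists>C>0. \<forall>H A. 1 \<le> H \<longrightarrow> real (card (lattice_shell (laplace_weight \<alpha>) H A)) \<le> C * real_of_int H powr \<kappa>"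
    and \<kappa>: "\<kappa> / 2 \<le> \<gamma>"
  shows "\<exists>C>0. \<forall>N f. 1 \<le> N \<longrightarrow> f \<in> torus_L2 \<alpha> \<longrightarrow> spectrum \<alpha> f \<subseteq> {n. \<forall>j. n $ j \<in> {-N..N}} \<longrightarrow>
    (strichartz_norm 4 4 I \<alpha> f)\<^sup>2 \<le> ennreal (C * real_of_int N powr \<gamma>) * (torus_norm 2 \<alpha> f)\<^sup>2"
proof -
  have \<alpha>0: "\<forall>j. 0 < \<alpha> $ j"
  proof
    fix j show "0 < \<alpha> $ j" using \<alpha>[rule_format, of j] by simp
  qed
  obtain B where B: "\<And>t. t \<in> I \<Longrightarrow> \<bar>t\<bar> \<le> B" using I(2) by (auto simp: bounded_iff)
  \<comment> \<open>Ensures both that I lies in [-T/2, T/2] and that T >= 2.\<close>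
  define T where "T = 2 * max 1 B"
  have T: "2 \<le> T" "I \<subseteq> {-T/2..T/2}" using B by (force simp: T_def abs_le_iff)+
  have Im: "I \<in> sets lebesgue"
    using I measurable_convex[of I] by (auto simp: is_interval_convex_1)
  obtain C0 where C0: "C0 > 0" "\<And>H A. 1 \<le> H \<Longrightarrow> real (card (lattice_shell (laplace_weight \<alpha>) H A)) \<le> C0 * real_of_int H powr \<kappa>"
    using count by blast
  define V where "V = torus_volume \<alpha>"
  have V: "0 < V" unfolding V_def by (rule torus_volume_pos[OF \<alpha>0])
  define C where "C = sqrt (240 * T ^ 3 * (C0 * 2 powr \<kappa>) / V)"
  have "(strichartz_norm 4 4 I \<alpha> f)\<^sup>2 \<le> ennreal (C * real_of_int N powr \<gamma>) * (torus_norm 2 \<alpha> f)\<^sup>2"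
    if N: "1 \<le> N" and f: "f \<in> torus_L2 \<alpha>" "spectrum \<alpha> f \<subseteq> {n. \<forall>j. n $ j \<in> {-N..N}}" for N f
  proof -
    let ?M = "C0 * (2 powr \<kappa> * real_of_int N powr \<kappa>)"
    have M: "real (card (lattice_shell (laplace_weight \<alpha>) (2 * N) A)) \<le> ?M" for A
      using C0(2)[of "2 * N" A] N by (simp add: powr_mult)
    have "(strichartz_norm 4 4 I \<alpha> f)\<^sup>2 \<le> ennreal (sqrt (240 * T ^ 3 * ?M / V)) * (torus_norm 2 \<alpha> f)\<^sup>2"
      unfolding V_def by (rule schrodinger_L4_le[OF \<alpha>0 T(1) Im T(2) M f])
    also have "sqrt (240 * T ^ 3 * ?M / V) = C * real_of_int N powr (\<kappa> / 2)"
    proof -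
      have "240 * T ^ 3 * ?M / V = (240 * T ^ 3 * (C0 * 2 powr \<kappa>) / V) * (real_of_int N powr (\<kappa> / 2))\<^sup>2"
        by (simp add: power2_eq_square flip: powr_add)
      then show ?thesis by (simp only: C_def real_sqrt_mult real_sqrt_abs) simp
    qed
    also have "ennreal (C * real_of_int N powr (\<kappa> / 2)) \<le> ennreal (C * real_of_int N powr \<gamma>)"
      using N \<kappa> T V C0(1) by (intro ennreal_leI mult_left_mono powr_mono) (auto simp: C_def)
    finally show ?thesis by (simp add: mult_right_mono)
  qed
  moreover have "C > 0" using T V C0(1) by (simp add: C_def)
  ultimately show ?thesis by blast
qed

theorem proposition1:
  fixes \<alpha> :: "real^'n::finite" and I :: "real set"
  assumes "2 \<le> CARD('n)"
    and "\<forall>j. \<alpha> $ j \<in> {1/2..2}"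
    and "is_interval I" and "bounded I"
  shows "\<forall>\<epsilon>::real. \<epsilon> > 0 \<longrightarrow> (\<exists>C::real. C > 0 \<and>
    (\<forall>N::int. \<forall>f. 1 \<le> N \<longrightarrow> f \<in> torus_L2 \<alpha> \<longrightarrow>
      spectrum \<alpha> f \<subseteq> {n. \<forall>j. n $ j \<in> {-N..N}} \<longrightarrow>
      (CARD('n) = 2 \<longrightarrow>
        (strichartz_norm 4 4 I \<alpha> f)\<^sup>2
          \<le> ennreal (C * real_of_int N powr (1/3)) * (torus_norm 2 \<alpha> f)\<^sup>2) \<and>
      (3 \<le> CARD('n) \<and> odd CARD('n) \<longrightarrow>
        (strichartz_norm 4 4 I \<alpha> f)\<^sup>2
          \<le> ennreal (C * real_of_int N powr
                (real CARD('n) / 2 - real CARD('n) / (real CARD('n) + 1) + \<epsilon>))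
              * (torus_norm 2 \<alpha> f)\<^sup>2) \<and>
      (4 \<le> CARD('n) \<and> even CARD('n) \<longrightarrow>
        (strichartz_norm 4 4 I \<alpha> f)\<^sup>2
          \<le> ennreal (C * real_of_int N powr (real CARD('n) / 2 - 1 + \<epsilon>))
              * (torus_norm 2 \<alpha> f)\<^sup>2)))"
proof (intro allI impI)
  fix \<epsilon> :: real assume \<epsilon>: "\<epsilon> > 0"
  note count = strichartz_of_lattice_count[OF assms(2-4)]
  have \<beta>: "\<forall>j. laplace_weight \<alpha> j \<in> {9..160}" using assms(2) laplace_weight_bounds by blast
  let ?d = "real CARD('n)"
  consider "CARD('n) = 2" | "CARD('n) = 3" | "4 \<le> CARD('n)" using assms(1) by linarith
  then show "\<exists>C::real. C > 0 \<and>
    (\<forall>N::int. \<forall>f. 1 \<le> N \<longrightarrow> f \<in> torus_L2 \<alpha> \<longrightarrow>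
      spectrum \<alpha> f \<subseteq> {n. \<forall>j. n $ j \<in> {-N..N}} \<longrightarrow>
      (CARD('n) = 2 \<longrightarrow>
        (strichartz_norm 4 4 I \<alpha> f)\<^sup>2
          \<le> ennreal (C * real_of_int N powr (1/3)) * (torus_norm 2 \<alpha> f)\<^sup>2) \<and>
      (3 \<le> CARD('n) \<and> odd CARD('n) \<longrightarrow>
        (strichartz_norm 4 4 I \<alpha> f)\<^sup>2
          \<le> ennreal (C * real_of_int N powr (?d / 2 - ?d / (?d + 1) + \<epsilon>)) * (torus_norm 2 \<alpha> f)\<^sup>2) \<and>
      (4 \<le> CARD('n) \<and> even CARD('n) \<longrightarrow>
        (strichartz_norm 4 4 I \<alpha> f)\<^sup>2
          \<le> ennreal (C * real_of_int N powr (?d / 2 - 1 + \<epsilon>)) * (torus_norm 2 \<alpha> f)\<^sup>2))"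
  proof cases
    case 1
    show ?thesis using count[OF card_lattice_shell_2[OF 1 \<beta>], of "1/3"] 1 by simp
  next
    case 2
    \<comment> \<open>For d = 3 the target is 3/2 - 3/4 + \<epsilon> = 3/4 + \<epsilon>, while half
      the counting exponent is 3/4 + \<epsilon>/2.\<close>
    show ?thesis using count[OF card_lattice_shell_3[OF 2 \<beta> \<epsilon>], of "?d / 2 - ?d / (?d + 1) + \<epsilon>"] 2 \<epsilon> by simp
  next
    case 3
    show ?thesis
    proof (cases "even CARD('n)")
      case True
      then show ?thesis
        using count[OF card_lattice_shell_ge_4[OF 3 \<beta> \<epsilon>], of "?d / 2 - 1 + \<epsilon>"] 3 \<epsilon> by simp
    next
      case False
      \<comment> \<open>For odd d >= 5 the count gives d/2 - 1 + \<epsilon>/2, which is below the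
        target because d / (d + 1) is at most 1.\<close>
      have "(?d - 2 + \<epsilon>) / 2 \<le> ?d / 2 - r + \<epsilon>" if "r \<le> 1" for r
        using that \<epsilon> by (simp add: field_simps)
      moreover have "?d / (?d + 1) \<le> 1" by simp
      ultimately have "(?d - 2 + \<epsilon>) / 2 \<le> ?d / 2 - ?d / (?d + 1) + \<epsilon>" by blast
      then show ?thesis
        using count[OF card_lattice_shell_ge_4[OF 3 \<beta> \<epsilon>], of "?d / 2 - ?d / (?d + 1) + \<epsilon>"] 3 False by auto
    qed
  qed
qed

end
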